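(* Suppose the pair $(p_{XY},p_{Z|XY})$ is in normal form. Then any secure protocol $\Pi(p_{XY},p_{Z|XY})$ satisfies \begin{align*} H(M_{23}) &\ge \max\{RI(X;Z),RI(X;Y)\}+H(Y,Z|X),\\ H(M_{31}) &\ge \max\{RI(Y;Z),RI(X;Y)\}+H(X,Z|Y),\\ H(M_{12}) &\ge \max\{RI(X;Z),RI(Y;Z)\}+H(X,Y|Z), \end{align*} where all quantities are computed under the joint distribution $p_{XY}(x,y)p_{Z|XY}(z|x,y)$ and the protocol.
   Context: Setting: $\mathcal X,\mathcal Y,\mathcal Z$ are finite sets. Alice (party 1) holds input $X\in\mathcal X$, Bob (party 2) holds $Y\in\mathcal Y$, with $(X,Y)\sim p_{XY}$; Charlie (party 3) has no input and outputs $Z\in\mathcal Z$. A randomized function is a conditional distribution $p_{Z|XY}$. In a protocol the three parties, each using private randomness, exchange messages over multiple rounds on three pairwise private links; each message on a link is a codeword of a prefix-free code determined by the previous messages on that link, and the protocol terminates with probability 1; it may depend on $p_{XY}$. $M_{12},M_{23},M_{31}$ are the final transcripts on the Alice–Bob, Bob–Charlie, Charlie–Alice links. A secure protocol $\Pi(p_{XY},p_{Z|XY})$ satisfies: (correctness) on inputs $x,y$ Charlie's output is distributed as $p_{Z|X=x,Y=y}$; (privacy) the Markov chains $(M_{12},M_{31})-X-(Y,Z)$, $(M_{12},M_{23})-Y-(X,Z)$, $(M_{23},M_{31})-Z-(X,Y)$ hold. Normal form of a pair: for $x,x'$ let $S_{x,x'}=\{y: p_{XY}(x,y)>0, p_{XY}(x',y)>0\}$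 and say $x\cong x'$ if $p(z|x,y)=p(z|x',y)$ for all $y\in S_{x,x'}$, $z\in\mathcal Z$; define $y\cong y'$ symmetrically; say $z\cong z'$ if there is $c\ge0$ with $p(z|x,y)=c\,p(z'|x,y)$ for all $(x,y)$ with $p_{XY}(x,y)>0$. The pair is in normal form if $x\cong x'\Rightarrow x=x'$, $y\cong y'\Rightarrow y=y'$, $z\cong z'\Rightarrow z=z'$. Residual information: $RI(U;V)=I(U;V)-H(U\sqcap V)$, where $U\sqcap V$ is a random variable of maximum entropy among those of the form $f(U)=g(V)$ for deterministic $f,g$. Logarithms base 2. *)

theory Defs
  imports "HOL-Probability.Probability" "HOL-Library.Sublist"
begin

text \<open>Shannon entropy of a pmf with finite support (used for X, Y, Z, which range over finite types).\<close>
definition ent :: "'a pmf \<Rightarrow> real" where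
  "ent p = (\<Sum>a\<in>set_pmf p. - (pmf p a * log 2 (pmf p a)))"

definition ent_inf :: "'a pmf \<Rightarrow> ennreal" where
  "ent_inf p = (\<integral>\<^sup>+ a. ennreal (- (pmf p a * log 2 (pmf p a))) \<partial>count_space UNIV)"

definition mutual_info :: "('a \<times> 'b) pmf \<Rightarrow> real" where
  "mutual_info P = ent (map_pmf fst P) + ent (map_pmf snd P) - ent P"

definition cond_ent :: "('a \<times> 'b) pmf \<Rightarrow> real" where
  "cond_ent P = ent P - ent (map_pmf snd P)"

definition common_info :: "('a \<times> 'b) pmf \<Rightarrow> real" where
  "common_info P = Sup {ent (map_pmf (\<lambda>(u,v). f u) P) | f g.
       \<forall>(u,v)\<in>set_pmf P. (f u :: nat) = g v}"

definition resid_info :: "('a \<times> 'b) pmf \<Rightarrow> real" where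
  "resid_info P = mutual_info P - common_info P"

definition markov :: "'w pmf \<Rightarrow> ('w \<Rightarrow> 'a) \<Rightarrow> ('w \<Rightarrow> 'b) \<Rightarrow> ('w \<Rightarrow> 'c) \<Rightarrow> bool" where
  "markov J fA fB fC \<longleftrightarrow> (\<forall>a b c.
     pmf (map_pmf (\<lambda>w. (fA w, fB w, fC w)) J) (a, b, c) * pmf (map_pmf fB J) b =
     pmf (map_pmf (\<lambda>w. (fA w, fB w)) J) (a, b) * pmf (map_pmf (\<lambda>w. (fB w, fC w)) J) (b, c))"

definition S_set :: "('x \<times> 'y) pmf \<Rightarrow> 'x \<Rightarrow> 'x \<Rightarrow> 'y set" where
  "S_set pXY x x' = {y. pmf pXY (x, y) > 0 \<and> pmf pXY (x', y) > 0}"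

definition T_set :: "('x \<times> 'y) pmf \<Rightarrow> 'y \<Rightarrow> 'y \<Rightarrow> 'x set" where
  "T_set pXY y y' = {x. pmf pXY (x, y) > 0 \<and> pmf pXY (x, y') > 0}"

definition equiv_x :: "('x \<times> 'y) pmf \<Rightarrow> ('x \<Rightarrow> 'y \<Rightarrow> 'z pmf) \<Rightarrow> 'x \<Rightarrow> 'x \<Rightarrow> bool" where
  "equiv_x pXY pZ x x' \<longleftrightarrow> (\<forall>y\<in>S_set pXY x x'. \<forall>z. pmf (pZ x y) z = pmf (pZ x' y) z)"

definition equiv_y :: "('x \<times> 'y) pmf \<Rightarrow> ('x \<Rightarrow> 'y \<Rightarrow> 'z pmf) \<Rightarrow> 'y \<Rightarrow> 'y \<Rightarrow> bool" where
  "equiv_y pXY pZ y y' \<longleftrightarrow> (\<forall>x\<in>T_set pXY y y'. \<forall>z. pmf (pZ x y) z = pmf (pZ x y') z)"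

definition equiv_z :: "('x \<times> 'y) pmf \<Rightarrow> ('x \<Rightarrow> 'y \<Rightarrow> 'z pmf) \<Rightarrow> 'z \<Rightarrow> 'z \<Rightarrow> bool" where
  "equiv_z pXY pZ z z' \<longleftrightarrow> (\<exists>c::real. c \<ge> 0 \<and>
     (\<forall>x y. pmf pXY (x, y) > 0 \<longrightarrow> pmf (pZ x y) z = c * pmf (pZ x y) z'))"

definition normal_form :: "('x \<times> 'y) pmf \<Rightarrow> ('x \<Rightarrow> 'y \<Rightarrow> 'z pmf) \<Rightarrow> bool" where
  "normal_form pXY pZ \<longleftrightarrow>
     (\<forall>x x'. equiv_x pXY pZ x x' \<longrightarrow> x = x') \<and>
     (\<forall>y y'. equiv_y pXY pZ y y' \<longrightarrow> y = y') \<and>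
     (\<forall>z z'. equiv_z pXY pZ z z' \<longrightarrow> z = z')"

text \<open>A link history is the round-by-round list of pairs of messages (bit strings) sent
  in the two directions of the link.  Orientation:
  link 12 stores (1\<rightarrow>2, 2\<rightarrow>1), link 23 stores (2\<rightarrow>3, 3\<rightarrow>2), link 31 stores (3\<rightarrow>1, 1\<rightarrow>3).\<close>
type_synonym hist = "(bool list \<times> bool list) list"

text \<open>Parties are numbered 1 (Alice), 2 (Bob), 3 (Charlie).  In round t each party draws its
  two outgoing messages (jointly) from a distribution depending on its whole view so far
  (its input and the histories of its two links); this is equivalent to using private
  randomness.  Charlie's output is drawn from a distribution depending on his final view,
  which is determined by the final transcripts of his two links.
  code i j t h is the prefix-free code for the round-t message from i to j, determined by the
  previous messages h on the link {i,j}.\<close>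
record ('x, 'y, 'z) protocol =
  party1 :: "nat \<Rightarrow> 'x \<Rightarrow> hist \<Rightarrow> hist \<Rightarrow> (bool list \<times> bool list) pmf"
    (* round, input x, history of link 12, history of link 31 \<mapsto> (msg to 2, msg to 3) *)
  party2 :: "nat \<Rightarrow> 'y \<Rightarrow> hist \<Rightarrow> hist \<Rightarrow> (bool list \<times> bool list) pmf"
    (* round, input y, history of link 12, history of link 23 \<mapsto> (msg to 1, msg to 3) *)
  party3 :: "nat \<Rightarrow> hist \<Rightarrow> hist \<Rightarrow> (bool list \<times> bool list) pmf"
    (* round, history of link 23, history of link 31 \<mapsto> (msg to 1, msg to 2) *)
  output3 :: "bool list \<Rightarrow> bool list \<Rightarrow> 'z pmf"
    (* final transcripts M23, M31 \<mapsto> Charlie's output *)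
  code :: "nat \<Rightarrow> nat \<Rightarrow> nat \<Rightarrow> hist \<Rightarrow> bool list set"

definition prefix_free :: "bool list set \<Rightarrow> bool" where
  "prefix_free C \<longleftrightarrow> (\<forall>u\<in>C. \<forall>v\<in>C. prefix u v \<longrightarrow> u = v)"

definition valid_protocol :: "('x, 'y, 'z) protocol \<Rightarrow> bool" where
  "valid_protocol P \<longleftrightarrow>
     (\<forall>i j t h. prefix_free (code P i j t h)) \<and>
     (\<forall>t x h12 h31 a2 a3. (a2, a3) \<in> set_pmf (party1 P t x h12 h31) \<longrightarrow>
        a2 \<in> code P 1 2 t h12 \<and> a3 \<in> code P 1 3 t h31) \<and>
     (\<forall>t y h12 h23 b1 b3. (b1, b3) \<in> set_pmf (party2 P t y h12 h23) \<longrightarrow>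
        b1 \<in> code P 2 1 t h12 \<and> b3 \<in> code P 2 3 t h23) \<and>
     (\<forall>t h23 h31 c1 c2. (c1, c2) \<in> set_pmf (party3 P t h23 h31) \<longrightarrow>
        c1 \<in> code P 3 1 t h31 \<and> c2 \<in> code P 3 2 t h23)"

primrec exec :: "('x, 'y, 'z) protocol \<Rightarrow> 'x \<Rightarrow> 'y \<Rightarrow> nat \<Rightarrow> (hist \<times> hist \<times> hist) pmf" where
  "exec P x y 0 = return_pmf ([], [], [])"
| "exec P x y (Suc n) =
     exec P x y n \<bind> (\<lambda>(h12, h23, h31).
       party1 P n x h12 h31 \<bind> (\<lambda>(a2, a3).
       party2 P n y h12 h23 \<bind> (\<lambda>(b1, b3).
       party3 P n h23 h31 \<bind> (\<lambda>(c1, c2).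
       return_pmf (h12 @ [(a2, b1)], h23 @ [(b3, c2)], h31 @ [(c1, a3)])))))"

text \<open>The protocol has terminated after n rounds: from now on every code on every link is
  the trivial code containing only the empty word, so nothing more is ever sent.\<close>
definition finished :: "('x, 'y, 'z) protocol \<Rightarrow> nat \<Rightarrow> hist \<times> hist \<times> hist \<Rightarrow> bool" where
  "finished P n s \<longleftrightarrow> (case s of (h12, h23, h31) \<Rightarrow>
     (\<forall>k. let e = replicate k ([], []) in
        code P 1 2 (n + k) (h12 @ e) = {[]} \<and> code P 2 1 (n + k) (h12 @ e) = {[]} \<and>
        code P 2 3 (n + k) (h23 @ e) = {[]} \<and> code P 3 2 (n + k) (h23 @ e) = {[]} \<and>
        code P 3 1 (n + k) (h31 @ e) = {[]} \<and> code P 1 3 (n + k) (h31 @ e) = {[]}))"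

definition flat :: "hist \<Rightarrow> bool list" where
  "flat h = concat (map (\<lambda>(u, v). u @ v) h)"

definition transcripts :: "hist \<times> hist \<times> hist \<Rightarrow> bool list \<times> bool list \<times> bool list" where
  "transcripts s = (case s of (h12, h23, h31) \<Rightarrow> (flat h12, flat h23, flat h31))"

definition terminates :: "('x, 'y, 'z) protocol \<Rightarrow> 'x \<Rightarrow> 'y \<Rightarrow> bool" where
  "terminates P x y \<longleftrightarrow>
     (\<lambda>n. measure_pmf.prob (exec P x y n) {s. finished P n s}) \<longlonglongrightarrow> 1"

definition is_transcript_dist ::
  "('x, 'y, 'z) protocol \<Rightarrow> 'x \<Rightarrow> 'y \<Rightarrow> (bool list \<times> bool list \<times> bool list) pmf \<Rightarrow> bool" where
  "is_transcript_dist P x y Q \<longleftrightarrow> (\<forall>m.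
     (\<lambda>n. measure_pmf.prob (exec P x y n) {s. finished P n s \<and> transcripts s = m})
       \<longlonglongrightarrow> pmf Q m)"

definition joint ::
  "('x \<times> 'y) pmf \<Rightarrow> ('x, 'y, 'z) protocol \<Rightarrow> ('x \<Rightarrow> 'y \<Rightarrow> (bool list \<times> bool list \<times> bool list) pmf)
   \<Rightarrow> ('x \<times> 'y \<times> 'z \<times> bool list \<times> bool list \<times> bool list) pmf" where
  "joint pXY P Q = pXY \<bind> (\<lambda>(x, y). Q x y \<bind> (\<lambda>(m12, m23, m31).
      output3 P m23 m31 \<bind> (\<lambda>z. return_pmf (x, y, z, m12, m23, m31))))"

definition secure_protocol ::
  "('x \<times> 'y) pmf \<Rightarrow> ('x \<Rightarrow> 'y \<Rightarrow> 'z pmf) \<Rightarrow> ('x, 'y, 'z) protocol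
   \<Rightarrow> ('x \<Rightarrow> 'y \<Rightarrow> (bool list \<times> bool list \<times> bool list) pmf) \<Rightarrow> bool" where
  "secure_protocol pXY pZ P Q \<longleftrightarrow>
     valid_protocol P \<and>
     (\<forall>x y. pmf pXY (x, y) > 0 \<longrightarrow> terminates P x y \<and> is_transcript_dist P x y (Q x y)) \<and>
     \<comment> \<open>correctness\<close>
     (\<forall>x y. pmf pXY (x, y) > 0 \<longrightarrow>
        Q x y \<bind> (\<lambda>(m12, m23, m31). output3 P m23 m31) = pZ x y) \<and>
     \<comment> \<open>privacy\<close>
     (let J = joint pXY P Q in
        markov J (\<lambda>(x, y, z, m12, m23, m31). (m12, m31)) (\<lambda>(x, y, z, m). x) (\<lambda>(x, y, z, m). (y, z)) \<and>
        markov J (\<lambda>(x, y, z, m12, m23, m31). (m12, m23)) (\<lambda>(x, y, z, m). y) (\<lambda>(x, y, z, m). (x, z)) \<and>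
        markov J (\<lambda>(x, y, z, m12, m23, m31). (m23, m31)) (\<lambda>(x, y, z, m). z) (\<lambda>(x, y, z, m). (x, y)))"

end

theory Submission
  imports Defs
begin

text \<open>The transcript probabilities factor as \<open>\<alpha>(x,m12,m31) \<beta>(y,m12,m23) \<gamma>(m12,m23,m31)\<close>, so for fixed
  \<open>y\<close> and a fixed view \<open>(m12,m31)\<close> of Alice the output law depends on \<open>x\<close> only through a scalar.
  Together with privacy and the normal form this shows that Alice's view determines \<open>x\<close>;
  likewise Bob's view determines \<open>y\<close>, and Charlie's view determines \<open>z\<close>.

  Now let \<open>a\<close> be a link between parties with values \<open>u\<close> and \<open>r\<close>, let \<open>s\<close> be the value of the third
  party, \<open>c\<close> its link to the party of \<open>u\<close>, and \<open>b\<close> its link to the party of \<open>r\<close>. Privacy makes \<open>c\<close>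
  conditionally independent of \<open>(u,s)\<close> given some common function \<open>q\<close> of \<open>u\<close> and \<open>s\<close>, so that
  \<open>I(u;s|c) = I(u;s) - I(q;c) \<ge> RI(u;s)\<close>, while
  \<open>H(a) \<ge> I(a;b|c) + H(a|b,c) \<ge> I(u;s|c) + H(u,r|s)\<close>. These inequalities are merged into a single
  Gibbs inequality, which avoids mutual information between transcripts on infinite alphabets.\<close>

section \<open>Marginal laws and Markov chains\<close>

lemma pmf_map_eqI:
  assumes "\<And>w. w \<in> set_pmf J \<Longrightarrow> f w = u \<longleftrightarrow> g w = v"
  shows "pmf (map_pmf f J) u = pmf (map_pmf g J) v"
  unfolding pmf_map
  by (rule measure_pmf.finite_measure_eq_AE) (auto simp: AE_measure_pmf_iff assms)

lemma pmf_map_leI: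
  assumes "\<And>w. w \<in> set_pmf J \<Longrightarrow> f w = u \<Longrightarrow> g w = v"
  shows "pmf (map_pmf f J) u \<le> pmf (map_pmf g J) v"
  unfolding pmf_map
  by (rule measure_pmf.finite_measure_mono_AE) (auto simp: AE_measure_pmf_iff assms)

lemma pmf_map_pos: "w \<in> set_pmf J \<Longrightarrow> pmf (map_pmf f J) (f w) > 0"
  by (simp add: pmf_positive)

lemma pmf_map_posE:
  assumes "pmf (map_pmf f J) u > 0"
  obtains w where "w \<in> set_pmf J" "f w = u"
  using assms by (metis imageE order_less_irrefl set_map_pmf set_pmf_iff)

text \<open>Transcripts range over an infinite type. Working in \<open>ennreal\<close> lets the sum
  over a fibre of \<open>k\<close> be rearranged without summability conditions.\<close>

lemma pmf_map_comp_sum: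
  "ennreal (pmf (map_pmf (\<lambda>w. (f w, k (g w))) J) (u, d)) =
    (\<integral>\<^sup>+ c. ennreal (pmf (map_pmf (\<lambda>w. (f w, g w)) J) (u, c)) * indicator (k -` {d}) c \<partial>count_space UNIV)"
proof -
  let ?N = "map_pmf (\<lambda>w. (f w, g w)) J"
  let ?h = "\<lambda>(u, c). (u, k c)"
  have "ennreal (pmf (map_pmf (\<lambda>w. (f w, k (g w))) J) (u, d)) = ennreal (pmf (map_pmf ?h ?N) (u, d))"
    by (simp add: pmf.map_comp o_def)
  also have "\<dots> = (\<integral>\<^sup>+ v. indicator (?h -` {(u, d)}) v \<partial>measure_pmf ?N)"
    unfolding ennreal_pmf_map by simp
  also have "\<dots> = (\<integral>\<^sup>+ v. ennreal (pmf ?N v) * indicator (?h -` {(u, d)}) v \<partial>count_space UNIV)"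
    by (rule nn_integral_measure_pmf)
  also have "\<dots> = (\<integral>\<^sup>+ u'. \<integral>\<^sup>+ c. ennreal (pmf ?N (u', c)) * indicator (?h -` {(u, d)}) (u', c)
      \<partial>count_space UNIV \<partial>count_space UNIV)"
    by (rule nn_integral_fst_count_space[symmetric])
  also have "\<dots> = (\<integral>\<^sup>+ u'. (\<integral>\<^sup>+ c. ennreal (pmf ?N (u', c)) * indicator (k -` {d}) c
      \<partial>count_space UNIV) * indicator {u} u' \<partial>count_space UNIV)"
    by (rule nn_integral_cong) (auto split: split_indicator intro!: nn_integral_cong)
  also have "\<dots> = (\<integral>\<^sup>+ c. ennreal (pmf ?N (u, c)) * indicator (k -` {d}) c \<partial>count_space UNIV)"
    by (subst nn_integral_indicator_singleton) auto
  finally show ?thesis .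
qed

lemma pmf_map_marginal:
  "ennreal (pmf (map_pmf f J) u) =
    (\<integral>\<^sup>+ c. ennreal (pmf (map_pmf (\<lambda>w. (f w, g w)) J) (u, c)) \<partial>count_space UNIV)"
proof -
  have "pmf (map_pmf f J) u = pmf (map_pmf (\<lambda>w. (f w, (\<lambda>_. ()) (g w))) J) (u, ())"
    by (rule pmf_map_eqI) simp
  then show ?thesis
    by (simp only: pmf_map_comp_sum[of f "\<lambda>_. ()" g]) simp
qed

lemma markov_sym: "markov J fA fB fC \<Longrightarrow> markov J fC fB fA"
  unfolding markov_def
proof (intro allI)
  fix c b a
  assume *: "\<forall>a b c.
     pmf (map_pmf (\<lambda>w. (fA w, fB w, fC w)) J) (a, b, c) * pmf (map_pmf fB J) b =
     pmf (map_pmf (\<lambda>w. (fA w, fB w)) J) (a, b) * pmf (map_pmf (\<lambda>w. (fB w, fC w)) J) (b, c)"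
  have "pmf (map_pmf (\<lambda>w. (fC w, fB w, fA w)) J) (c, b, a) = pmf (map_pmf (\<lambda>w. (fA w, fB w, fC w)) J) (a, b, c)"
    "pmf (map_pmf (\<lambda>w. (fC w, fB w)) J) (c, b) = pmf (map_pmf (\<lambda>w. (fB w, fC w)) J) (b, c)"
    "pmf (map_pmf (\<lambda>w. (fB w, fA w)) J) (b, a) = pmf (map_pmf (\<lambda>w. (fA w, fB w)) J) (a, b)"
    by (rule pmf_map_eqI, blast)+
  with * show "pmf (map_pmf (\<lambda>w. (fC w, fB w, fA w)) J) (c, b, a) * pmf (map_pmf fB J) b =
     pmf (map_pmf (\<lambda>w. (fC w, fB w)) J) (c, b) * pmf (map_pmf (\<lambda>w. (fB w, fA w)) J) (b, a)"
    by simp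
qed

text \<open>Each side of the Markov identity has exactly one factor carrying \<open>c\<close>, so
  the identity survives summation over a fibre of \<open>k\<close>.\<close>

lemma markov_comp_right:
  assumes "markov J fA fB fC"
  shows "markov J fA fB (\<lambda>w. k (fC w))"
  unfolding markov_def
proof (intro allI)
  fix a b d
  have assoc: "pmf (map_pmf (\<lambda>w. (fA w, fB w, h (fC w))) J) (a, b, c) =
      pmf (map_pmf (\<lambda>w. ((fA w, fB w), h (fC w))) J) ((a, b), c)" for h :: "_ \<Rightarrow> 'z" and c
    by (rule pmf_map_eqI) auto
  have assoc': "pmf (map_pmf (\<lambda>w. ((fA w, fB w), fC w)) J) ((a, b), c) =
      pmf (map_pmf (\<lambda>w. (fA w, fB w, fC w)) J) (a, b, c)" for c
    by (rule pmf_map_eqI) auto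
  have "ennreal (pmf (map_pmf (\<lambda>w. (fA w, fB w, k (fC w))) J) (a, b, d) * pmf (map_pmf fB J) b) =
     (\<integral>\<^sup>+ c. ennreal (pmf (map_pmf (\<lambda>w. (fA w, fB w, fC w)) J) (a, b, c)) * indicator (k -` {d}) c \<partial>count_space UNIV)
     * ennreal (pmf (map_pmf fB J) b)"
    unfolding assoc
    by (simp add: ennreal_mult pmf_map_comp_sum[of "\<lambda>w. (fA w, fB w)" k fC] assoc')
  also have "\<dots> = (\<integral>\<^sup>+ c. ennreal (pmf (map_pmf (\<lambda>w. (fA w, fB w, fC w)) J) (a, b, c) * pmf (map_pmf fB J) b)
      * indicator (k -` {d}) c \<partial>count_space UNIV)"
    by (subst nn_integral_multc[symmetric]) (auto simp: ennreal_mult ac_simps)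
  also have "\<dots> = (\<integral>\<^sup>+ c. ennreal (pmf (map_pmf (\<lambda>w. (fA w, fB w)) J) (a, b)) *
      (ennreal (pmf (map_pmf (\<lambda>w. (fB w, fC w)) J) (b, c)) * indicator (k -` {d}) c) \<partial>count_space UNIV)"
    using assms unfolding markov_def by (simp add: ennreal_mult ac_simps)
  also have "\<dots> = ennreal (pmf (map_pmf (\<lambda>w. (fA w, fB w)) J) (a, b)) *
      ennreal (pmf (map_pmf (\<lambda>w. (fB w, k (fC w))) J) (b, d))"
    by (subst nn_integral_cmult) (auto simp: pmf_map_comp_sum[of fB k fC])
  finally show "pmf (map_pmf (\<lambda>w. (fA w, fB w, k (fC w))) J) (a, b, d) * pmf (map_pmf fB J) b =
     pmf (map_pmf (\<lambda>w. (fA w, fB w)) J) (a, b) * pmf (map_pmf (\<lambda>w. (fB w, k (fC w))) J) (b, d)"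
    by (simp flip: ennreal_mult)
qed

lemma markov_comp:
  assumes "markov J fA fB fC" "\<And>w. gA w = h (fA w)" "\<And>w. gC w = k (fC w)"
  shows "markov J gA fB gC"
proof -
  have "gA = (\<lambda>w. h (fA w))" "gC = (\<lambda>w. k (fC w))" using assms(2,3) by auto
  then show ?thesis
    using markov_sym[OF markov_comp_right[OF markov_sym[OF markov_comp_right[OF assms(1)]]]] by simp
qed

lemma markovD:
  "markov J fA fB fC \<Longrightarrow>
     pmf (map_pmf (\<lambda>w. (fA w, fB w, fC w)) J) (a, b, c) * pmf (map_pmf fB J) b =
     pmf (map_pmf (\<lambda>w. (fA w, fB w)) J) (a, b) * pmf (map_pmf (\<lambda>w. (fB w, fC w)) J) (b, c)"
  unfolding markov_def by blast

section \<open>Entropy\<close>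

text \<open>All entropies become expectations on the one space \<open>J\<close>, so sums and
  differences of them turn into the expectation of a single logarithm.\<close>

lemma ent_map_eq_integral:
  fixes f :: "'w \<Rightarrow> 'a"
  assumes "finite (range f)"
  shows "ent (map_pmf f J) = (\<integral>w. - log 2 (pmf (map_pmf f J) (f w)) \<partial>measure_pmf J)"
    and "integrable (measure_pmf J) (\<lambda>w. log 2 (pmf (map_pmf f J) (f w)))"
proof -
  let ?N = "map_pmf f J"
  have fin: "finite (set_pmf ?N)" by (simp, rule finite_subset[OF _ assms]) auto
  have "(\<integral>w. - log 2 (pmf ?N (f w)) \<partial>measure_pmf J) = (\<integral>a. - log 2 (pmf ?N a) \<partial>measure_pmf ?N)"
    by simp
  also have "\<dots> = (\<Sum>a\<in>set_pmf ?N. - log 2 (pmf ?N a) * pmf ?N a)"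
    by (rule integral_measure_pmf_real[OF fin]) auto
  also have "\<dots> = ent ?N"
    unfolding ent_def by (intro sum.cong) auto
  finally show "ent ?N = (\<integral>w. - log 2 (pmf ?N (f w)) \<partial>measure_pmf J)" ..
  have "integrable (measure_pmf ?N) (\<lambda>a. log 2 (pmf ?N a))"
    using fin by (rule integrable_measure_pmf_finite)
  then show "integrable (measure_pmf J) (\<lambda>w. log 2 (pmf ?N (f w)))" by simp
qed

lemma minus_log_pmf_nonneg: "0 \<le> - log 2 (pmf p a)"
  by (cases "pmf p a = 0") (simp_all add: log_def pmf_le_1 pmf_pos divide_nonpos_pos)

lemma ent_inf_map_eq:
  "ent_inf (map_pmf f J) = (\<integral>\<^sup>+ w. ennreal (- log 2 (pmf (map_pmf f J) (f w))) \<partial>measure_pmf J)"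
proof -
  have "ent_inf (map_pmf f J) = (\<integral>\<^sup>+ a. ennreal (- log 2 (pmf (map_pmf f J) a)) \<partial>measure_pmf (map_pmf f J))"
    unfolding ent_inf_def nn_integral_measure_pmf
    by (intro nn_integral_cong) (simp flip: ennreal_mult[OF pmf_nonneg minus_log_pmf_nonneg])
  then show ?thesis by simp
qed

text \<open>The supremum in \<open>common_info\<close> is taken over reals, so membership yields an
  upper bound only once the set is bounded. A crude bound suffices: at most \<open>CARD('u)\<close>
  values, each contributing at most \<open>1 / ln 2\<close>.\<close>

lemma bdd_above_common_info:
  fixes N :: "('u::finite \<times> 'v) pmf"
  shows "bdd_above {ent (map_pmf (\<lambda>(u,v). f u) N) | (f :: 'u \<Rightarrow> nat) g. \<forall>(u,v)\<in>set_pmf N. f u = g v}"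
proof (rule bdd_aboveI)
  fix e assume "e \<in> {ent (map_pmf (\<lambda>(u,v). f u) N) | (f :: 'u \<Rightarrow> nat) g. \<forall>(u,v)\<in>set_pmf N. f u = g v}"
  then obtain f :: "'u \<Rightarrow> nat" where e: "e = ent (map_pmf (\<lambda>(u,v). f u) N)" by blast
  let ?M = "map_pmf (\<lambda>(u,v). f u) N"
  have sub: "set_pmf ?M \<subseteq> range f" by auto
  have "- (pmf ?M a * log 2 (pmf ?M a)) \<le> 1 / ln 2" if "a \<in> set_pmf ?M" for a
  proof -
    let ?p = "pmf ?M a"
    have p: "?p > 0" using that by (rule pmf_positive)
    have "- ln ?p \<le> 1 / ?p - 1" using ln_le_minus_one[of "1 / ?p"] p by (simp add: ln_div)
    then have "?p * (- ln ?p) \<le> ?p * (1 / ?p - 1)" using p by (intro mult_left_mono) auto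
    also have "\<dots> \<le> 1" using p by (simp add: field_simps)
    finally show ?thesis by (simp add: log_def divide_simps)
  qed
  then have "e \<le> of_nat (card (set_pmf ?M)) * (1 / ln 2)"
    unfolding e ent_def by (rule sum_bounded_above)
  also have "\<dots> \<le> of_nat CARD('u) * (1 / ln 2)"
    using card_mono[OF _ sub] card_image_le[of UNIV f]
    by (intro mult_right_mono) auto
  finally show "e \<le> of_nat CARD('u) * (1 / ln 2)" .
qed

text \<open>This is \<open>ln t <= t - 1\<close> at \<open>t = F w / G w\<close>, averaged over
  \<open>J\<close>. The bound on the mean ratio takes the place of normalization of the two
  weights.\<close>

lemma gibbs_inequality:
  fixes F G :: "'w \<Rightarrow> real"
  assumes pos: "\<And>w. w \<in> set_pmf J \<Longrightarrow> F w > 0" "\<And>w. w \<in> set_pmf J \<Longrightarrow> G w > 0"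
    and int: "integrable (measure_pmf J) (\<lambda>w. log 2 (F w))" "integrable (measure_pmf J) (\<lambda>w. log 2 (G w))"
    and le: "(\<integral>\<^sup>+ w. ennreal (F w / G w) \<partial>measure_pmf J) \<le> 1"
  shows "(\<integral>w. - log 2 (G w) \<partial>measure_pmf J) \<le> (\<integral>w. - log 2 (F w) \<partial>measure_pmf J)"
proof -
  have nn: "AE w in measure_pmf J. 0 \<le> F w / G w"
    using pos by (auto simp: AE_measure_pmf_iff intro!: divide_nonneg_pos less_imp_le)
  have i: "integrable (measure_pmf J) (\<lambda>w. F w / G w)"
    using nn le by (intro integrableI_nonneg) (auto simp: less_top[symmetric] top_unique)
  have "ennreal (\<integral>w. F w / G w \<partial>measure_pmf J) \<le> 1"
    using nn_integral_eq_integral[OF i nn] le by simp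
  then have le1: "(\<integral>w. F w / G w \<partial>measure_pmf J) \<le> 1"
    by simp
  have "(\<integral>w. log 2 (F w) - log 2 (G w) \<partial>measure_pmf J) \<le> (\<integral>w. (F w / G w - 1) / ln 2 \<partial>measure_pmf J)"
  proof (rule integral_mono_AE)
    show "AE w in measure_pmf J. log 2 (F w) - log 2 (G w) \<le> (F w / G w - 1) / ln 2"
      unfolding AE_measure_pmf_iff
    proof
      fix w assume w: "w \<in> set_pmf J"
      have "ln (F w / G w) \<le> F w / G w - 1"
        using pos[OF w] by (intro ln_le_minus_one) auto
      then show "log 2 (F w) - log 2 (G w) \<le> (F w / G w - 1) / ln 2"
        using pos[OF w] by (simp add: log_def ln_div divide_right_mono flip: diff_divide_distrib)
    qed
  qed (use int i in auto)
  also have "\<dots> \<le> 0" using i le1 by (simp add: divide_nonpos_pos)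
  finally show ?thesis using int by simp
qed

lemma pmf_map_comp_sum_finite:
  fixes g :: "'w \<Rightarrow> 'b::finite"
  shows "pmf (map_pmf (\<lambda>w. (f w, k (g w))) J) (u, d) =
    (\<Sum>c\<in>k -` {d}. pmf (map_pmf (\<lambda>w. (f w, g w)) J) (u, c))"
proof -
  have "ennreal (pmf (map_pmf (\<lambda>w. (f w, k (g w))) J) (u, d)) =
      (\<Sum>c\<in>UNIV. ennreal (pmf (map_pmf (\<lambda>w. (f w, g w)) J) (u, c)) * indicator (k -` {d}) c)"
    by (simp only: pmf_map_comp_sum nn_integral_count_space_finite[OF finite])
  also have "\<dots> = (\<Sum>c\<in>k -` {d}. ennreal (pmf (map_pmf (\<lambda>w. (f w, g w)) J) (u, c)))"
    by (intro sum.mono_neutral_cong_right) auto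
  finally show ?thesis by (simp add: sum_nonneg)
qed

section \<open>Common functions and the entropy of a single link\<close>

abbreviation (input) law :: "'w pmf \<Rightarrow> ('w \<Rightarrow> 'a) \<Rightarrow> 'a \<Rightarrow> real"
  where "law J f u \<equiv> pmf (map_pmf f J) u"

text \<open>The common function is a name for the conditional law of \<open>C\<close> given \<open>U\<close>, which the two Markov
  chains identify with the conditional law of \<open>C\<close> given \<open>S\<close>.\<close>

lemma double_markov_common_function:
  fixes J :: "'w pmf" and C :: "'w \<Rightarrow> 'c" and U :: "'w \<Rightarrow> 'u::finite" and S :: "'w \<Rightarrow> 's::finite"
  assumes markS: "markov J C S U" and markU: "markov J C U S"
  obtains q :: "'u \<Rightarrow> nat" and r :: "'s \<Rightarrow> nat"
  where "\<And>w. w \<in> set_pmf J \<Longrightarrow> q (U w) = r (S w)"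
    and "\<And>c u. law J (\<lambda>w. (C w, U w)) (c, u) * law J (\<lambda>w. q (U w)) (q u) =
      law J U u * law J (\<lambda>w. (C w, q (U w))) (c, q u)"
proof -
  \<comment> \<open>Conditional laws of \<open>C\<close> given \<open>U\<close> and given
    \<open>S\<close>. At a value of probability zero, division by zero makes them the zero
    function.\<close>
  define \<kappa>U where "\<kappa>U u c = law J (\<lambda>w. (C w, U w)) (c, u) / law J U u" for u c
  define \<kappa>S where "\<kappa>S s c = law J (\<lambda>w. (C w, S w)) (c, s) / law J S s" for s c
  have joint: "law J (\<lambda>w. (C w, U w)) (c, u) = \<kappa>U u c * law J U u" for c u
  proof (cases "law J U u = 0")
    case True
    have "law J (\<lambda>w. (C w, U w)) (c, u) \<le> law J U u"
      by (rule pmf_map_leI) simp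
    with True show ?thesis by (metis antisym mult_zero_right pmf_nonneg)
  qed (simp add: \<kappa>U_def)
  \<comment> \<open>On the support both quotients equal the conditional law of \<open>C\<close>
    given the pair of \<open>U\<close> and \<open>S\<close>.\<close>
  have agree: "\<kappa>U (U w) = \<kappa>S (S w)" if w: "w \<in> set_pmf J" for w
  proof
    fix c
    let ?u = "U w" and ?s = "S w"
    have pos: "law J U ?u > 0" "law J S ?s > 0" "law J (\<lambda>w. (U w, S w)) (?u, ?s) > 0"
      using w by (simp_all add: pmf_map_pos[of w J "\<lambda>w. (U w, S w)"] pmf_map_pos)
    have sw: "law J (\<lambda>w. (C w, S w, U w)) (c, ?s, ?u) = law J (\<lambda>w. (C w, U w, S w)) (c, ?u, ?s)"
      "law J (\<lambda>w. (S w, U w)) (?s, ?u) = law J (\<lambda>w. (U w, S w)) (?u, ?s)"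
      by (rule pmf_map_eqI, auto)+
    have "\<kappa>U ?u c = law J (\<lambda>w. (C w, U w, S w)) (c, ?u, ?s) / law J (\<lambda>w. (U w, S w)) (?u, ?s)"
      using markovD[OF markU, of c ?u ?s] pos by (simp add: \<kappa>U_def field_simps)
    also have "\<dots> = \<kappa>S ?s c"
      using markovD[OF markS, of c ?s ?u] pos by (simp add: \<kappa>S_def sw field_simps)
    finally show "\<kappa>U ?u c = \<kappa>S ?s c" .
  qed
  \<comment> \<open>\<open>common_info\<close> asks for natural-valued functions. Since
    \<open>'u\<close> and \<open>'s\<close> are finite, only finitely many laws occur, and
    \<open>enc\<close> numbers them injectively.\<close>
  have "finite (range \<kappa>U \<union> range \<kappa>S)" by simp
  then obtain enc :: "('c \<Rightarrow> real) \<Rightarrow> nat" where inj: "inj_on enc (range \<kappa>U \<union> range \<kappa>S)"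
    using finite_imp_inj_to_nat_seg by metis
  show thesis
  proof
    show "enc (\<kappa>U (U w)) = enc (\<kappa>S (S w))" if "w \<in> set_pmf J" for w
      using agree[OF that] by simp
    fix c u
    \<comment> \<open>\<open>?Q\<close> is the class of values with the same conditional law as
      \<open>u\<close>. Averaging the conditional laws over a class on which they coincide returns
      the same law.\<close>
    let ?Q = "{v. enc (\<kappa>U v) = enc (\<kappa>U u)}"
    have q: "law J (\<lambda>w. enc (\<kappa>U (U w))) (enc (\<kappa>U u)) = (\<Sum>v\<in>?Q. law J U v)"
    proof -
      have "law J (\<lambda>w. enc (\<kappa>U (U w))) (enc (\<kappa>U u)) =
          law J (\<lambda>w. ((), (\<lambda>v. enc (\<kappa>U v)) (U w))) ((), enc (\<kappa>U u))"
        by (rule pmf_map_eqI) simp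
      also have "\<dots> = (\<Sum>v\<in>?Q. law J (\<lambda>w. ((), U w)) ((), v))"
        by (subst pmf_map_comp_sum_finite) (simp add: vimage_def)
      also have "\<dots> = (\<Sum>v\<in>?Q. law J U v)"
        by (intro sum.cong pmf_map_eqI) auto
      finally show ?thesis .
    qed
    have "law J (\<lambda>w. (C w, enc (\<kappa>U (U w)))) (c, enc (\<kappa>U u)) = (\<Sum>v\<in>?Q. law J (\<lambda>w. (C w, U w)) (c, v))"
      by (subst pmf_map_comp_sum_finite[of C "\<lambda>v. enc (\<kappa>U v)" U]) (simp add: vimage_def)
    also have "\<dots> = (\<Sum>v\<in>?Q. \<kappa>U u c * law J U v)"
    proof (rule sum.cong)
      fix v assume "v \<in> ?Q"
      then have "\<kappa>U v = \<kappa>U u" using inj by (auto dest: inj_onD)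
      then show "law J (\<lambda>w. (C w, U w)) (c, v) = \<kappa>U u c * law J U v"
        using joint[of c v] by simp
    qed simp
    finally have "law J (\<lambda>w. (C w, enc (\<kappa>U (U w)))) (c, enc (\<kappa>U u)) =
        \<kappa>U u c * law J (\<lambda>w. enc (\<kappa>U (U w))) (enc (\<kappa>U u))"
      by (simp add: q sum_distrib_left)
    then show "law J (\<lambda>w. (C w, U w)) (c, u) * law J (\<lambda>w. enc (\<kappa>U (U w))) (enc (\<kappa>U u)) =
      law J U u * law J (\<lambda>w. (C w, enc (\<kappa>U (U w)))) (c, enc (\<kappa>U u))"
      using joint[of c u] by simp
  qed
qed

text \<open>The Gibbs inequality is applied to the weights \<open>p(a)\<close> and \<open>p(u|q) p(r|u,s)\<close>. No entropy of \<open>B\<close>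
  or \<open>C\<close> appears, and these may well be infinite.\<close>

lemma link_entropy_bound:
  fixes J :: "'w pmf" and A :: "'w \<Rightarrow> 'a" and B :: "'w \<Rightarrow> 'b" and C :: "'w \<Rightarrow> 'c"
    and U :: "'w \<Rightarrow> 'u::finite" and R :: "'w \<Rightarrow> 'r::finite" and S :: "'w \<Rightarrow> 's::finite"
  assumes detU: "\<And>v w. v \<in> set_pmf J \<Longrightarrow> w \<in> set_pmf J \<Longrightarrow> A v = A w \<Longrightarrow> C v = C w \<Longrightarrow> U v = U w"
    and detS: "\<And>v w. v \<in> set_pmf J \<Longrightarrow> w \<in> set_pmf J \<Longrightarrow> B v = B w \<Longrightarrow> C v = C w \<Longrightarrow> S v = S w"
    and detR: "\<And>v w. v \<in> set_pmf J \<Longrightarrow> w \<in> set_pmf J \<Longrightarrow> A v = A w \<Longrightarrow> B v = B w \<Longrightarrow> R v = R w"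
    and markS: "markov J (\<lambda>w. (B w, C w)) S (\<lambda>w. (U w, R w))"
    and markU: "markov J C U S"
  shows "ennreal (resid_info (map_pmf (\<lambda>w. (S w, U w)) J) + cond_ent (map_pmf (\<lambda>w. ((U w, R w), S w)) J))
    \<le> ent_inf (map_pmf A J)"
proof (cases "ent_inf (map_pmf A J) = \<infinity>")
  \<comment> \<open>An infinite entropy of \<open>A\<close> makes the bound trivial; a finite one
    makes \<open>log 2 (F w)\<close> integrable.\<close>
  case False
  have markCS: "markov J C S U"
    by (rule markov_comp[OF markS, where h = snd and k = fst]) auto
  have markBS: "markov J (\<lambda>w. (B w, C w)) S U"
    by (rule markov_comp[OF markS, where h = id and k = fst]) auto
  obtain q :: "'u \<Rightarrow> nat" and r :: "'s \<Rightarrow> nat"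
    where agree: "\<And>w. w \<in> set_pmf J \<Longrightarrow> q (U w) = r (S w)"
      and split: "\<And>c u. law J (\<lambda>w. (C w, U w)) (c, u) * law J (\<lambda>w. q (U w)) (q u) =
        law J U u * law J (\<lambda>w. (C w, q (U w))) (c, q u)"
    using double_markov_common_function[OF markCS markU] by blast
  define Q where "Q w = q (U w)" for w
  define SU where "SU = (\<lambda>w. (S w, U w))"
  define URS where "URS = (\<lambda>w. ((U w, R w), S w))"
  have finQ: "finite (range Q)" unfolding Q_def by (rule finite_subset[of _ "range q"]) auto
  \<comment> \<open>\<open>r\<close> and \<open>q\<close> are a witness pair for the supremum that
    defines \<open>common_info\<close>.\<close>
  have common: "ent (map_pmf Q J) \<le> common_info (map_pmf SU J)"
    unfolding common_info_def
  proof (rule cSup_upper[OF _ bdd_above_common_info])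
    have "map_pmf Q J = map_pmf (\<lambda>(s, u). r s) (map_pmf SU J)"
      using agree by (auto simp: pmf.map_comp o_def Q_def SU_def intro!: map_pmf_cong)
    moreover have "\<forall>(s, u)\<in>set_pmf (map_pmf SU J). r s = q u"
      using agree by (auto simp: SU_def)
    ultimately show "ent (map_pmf Q J) \<in> {ent (map_pmf (\<lambda>(u, v). f u) (map_pmf SU J)) |f g.
        \<forall>(u, v)\<in>set_pmf (map_pmf SU J). (f u :: nat) = g v}"
      by (intro CollectI exI[of _ r] exI[of _ q] conjI) auto
  qed
  define F where "F w = law J A (A w)" for w
  \<comment> \<open>\<open>Q\<close> is a function of \<open>U\<close>, so the first quotient is a
    conditional probability. The mean of \<open>- log 2 (G w)\<close> is
    \<open>H(U|Q) + H(R|U,S)\<close>, which exceeds the target by the nonnegative gap between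
    \<open>common_info\<close> and the entropy of \<open>Q\<close>.\<close>
  define G where "G w = law J U (U w) / law J Q (Q w) * (law J URS (URS w) / law J SU (SU w))" for w
  have Gpos: "G w > 0" if "w \<in> set_pmf J" for w
    unfolding G_def using that by (intro mult_pos_pos divide_pos_pos pmf_map_pos)
  have logG: "log 2 (G w) = log 2 (law J U (U w)) - log 2 (law J Q (Q w))
      + (log 2 (law J URS (URS w)) - log 2 (law J SU (SU w)))" if "w \<in> set_pmf J" for w
    unfolding G_def
    using pmf_map_pos[OF that, of U] pmf_map_pos[OF that, of Q] pmf_map_pos[OF that, of URS] pmf_map_pos[OF that, of SU]
    by (simp add: log_mult log_divide)
  note ints = ent_map_eq_integral(2)[OF finite, of J U] ent_map_eq_integral(2)[OF finQ, of J]
     ent_map_eq_integral(2)[OF finite, of J URS] ent_map_eq_integral(2)[OF finite, of J SU]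
  have intG': "integrable (measure_pmf J) (\<lambda>w. log 2 (law J U (U w)) - log 2 (law J Q (Q w))
      + (log 2 (law J URS (URS w)) - log 2 (law J SU (SU w))))"
    using ints by simp
  have intG: "integrable (measure_pmf J) (\<lambda>w. log 2 (G w))"
    by (rule iffD2[OF integrable_cong_AE intG']) (auto simp: AE_measure_pmf_iff logG)
  have "(\<integral>w. - log 2 (G w) \<partial>measure_pmf J) = (\<integral>w. - (log 2 (law J U (U w)) - log 2 (law J Q (Q w))
      + (log 2 (law J URS (URS w)) - log 2 (law J SU (SU w)))) \<partial>measure_pmf J)"
    by (rule integral_cong_AE) (auto simp: AE_measure_pmf_iff logG)
  also have "\<dots> = ent (map_pmf U J) - ent (map_pmf Q J) + ent (map_pmf URS J) - ent (map_pmf SU J)"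
    using ints by (simp add: ent_map_eq_integral(1)[OF finite] ent_map_eq_integral(1)[OF finQ])
  finally have entG: "(\<integral>w. - log 2 (G w) \<partial>measure_pmf J) =
      ent (map_pmf U J) - ent (map_pmf Q J) + ent (map_pmf URS J) - ent (map_pmf SU J)" .
  have intF: "integrable (measure_pmf J) (\<lambda>w. - log 2 (F w))"
    using False unfolding ent_inf_map_eq F_def
    by (intro integrableI_nonneg) (auto simp: minus_log_pmf_nonneg[simplified] less_top)
  have entF: "ent_inf (map_pmf A J) = ennreal (\<integral>w. - log 2 (F w) \<partial>measure_pmf J)"
    unfolding ent_inf_map_eq F_def[symmetric]
    by (rule nn_integral_eq_integral[OF intF]) (simp add: F_def minus_log_pmf_nonneg[simplified])

  \<comment> \<open>Decoders that recover \<open>U\<close>, \<open>S\<close>, \<open>R\<close> from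
    pairs among \<open>A\<close>, \<open>B\<close>, \<open>C\<close>, so that
    \<open>F w / G w\<close> becomes a function \<open>\<phi>\<close> of these three alone. Off the
    support their values are arbitrary.\<close>
  define u where "u a c = U (SOME w. w \<in> set_pmf J \<and> A w = a \<and> C w = c)" for a c
  define s where "s b c = S (SOME w. w \<in> set_pmf J \<and> B w = b \<and> C w = c)" for b c
  define \<rho> where "\<rho> a b = R (SOME w. w \<in> set_pmf J \<and> A w = a \<and> B w = b)" for a b
  have u: "u (A w) (C w) = U w" if "w \<in> set_pmf J" for w
    unfolding u_def using someI[of "\<lambda>v. v \<in> set_pmf J \<and> A v = A w \<and> C v = C w" w] that
    by (intro detU) auto
  have s: "s (B w) (C w) = S w" if "w \<in> set_pmf J" for w
    unfolding s_def using someI[of "\<lambda>v. v \<in> set_pmf J \<and> B v = B w \<and> C v = C w" w] that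
    by (intro detS) auto
  have \<rho>: "\<rho> (A w) (B w) = R w" if "w \<in> set_pmf J" for w
    unfolding \<rho>_def using someI[of "\<lambda>v. v \<in> set_pmf J \<and> A v = A w \<and> B v = B w" w] that
    by (intro detR) auto
  define ACB where "ACB w = (A w, C w, B w)" for w
  define \<phi> where "\<phi> = (\<lambda>(a, c, b). law J A a /
      (law J U (u a c) / law J Q (q (u a c)) *
        (law J URS ((u a c, \<rho> a b), s b c) / law J SU (s b c, u a c))))"
  define \<psi> where "\<psi> = (\<lambda>(a, c, b). law J A a *
      (law J Q (q (u a c)) / law J U (u a c) * law J (\<lambda>w. ((C w, U w), B w)) ((c, u a c), b)))"
  \<comment> \<open>On the support, \<open>p(a,c,b) <= p(b,c,s,u,r) = p(b,c|s) p(s,u,r)\<close>.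
    Dividing by \<open>p(r|u,s)\<close> leaves \<open>p(b,c,s,u)\<close>, which is at most
    \<open>p(b,c,u)\<close>. Off the support the left side is zero.\<close>
  have pointwise: "law J ACB t * \<phi> t \<le> \<psi> t" for t
  proof (cases "law J ACB t = 0")
    case True
    have "0 \<le> \<psi> t" unfolding \<psi>_def by (auto split: prod.split)
    with True show ?thesis by simp
  next
    case False
    then obtain w where w: "w \<in> set_pmf J" and t: "t = (A w, C w, B w)"
      using pmf_map_posE[of ACB J t] by (auto simp: ACB_def pmf_pos)
    let ?bs = "law J (\<lambda>w. ((B w, C w), S w)) ((B w, C w), S w)"
    have pos: "law J A (A w) > 0" "law J U (U w) > 0" "law J S (S w) > 0" "law J Q (q (U w)) > 0"
      "law J URS ((U w, R w), S w) > 0" "law J SU (S w, U w) > 0"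
      using pmf_map_pos[OF w, of A] pmf_map_pos[OF w, of U] pmf_map_pos[OF w, of S]
        pmf_map_pos[OF w, of Q] pmf_map_pos[OF w, of URS] pmf_map_pos[OF w, of SU]
      by (simp_all add: Q_def URS_def SU_def)
    have "law J ACB t \<le> law J (\<lambda>w. ((B w, C w), S w, U w, R w)) ((B w, C w), S w, U w, R w)"
      by (rule pmf_map_leI) (auto simp: ACB_def t intro: detU detS detR w)
    also have "\<dots> = ?bs * law J (\<lambda>w. (S w, U w, R w)) (S w, U w, R w) / law J S (S w)"
      using markovD[OF markS, of "(B w, C w)" "S w" "(U w, R w)"] pos by (simp add: field_simps)
    also have "law J (\<lambda>w. (S w, U w, R w)) (S w, U w, R w) = law J URS ((U w, R w), S w)"
      by (rule pmf_map_eqI) (auto simp: URS_def)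
    finally have 1: "law J ACB t * law J SU (S w, U w) / law J URS ((U w, R w), S w) \<le>
        ?bs * law J SU (S w, U w) / law J S (S w)"
      using pos by (simp add: field_simps)
    have "?bs * law J SU (S w, U w) / law J S (S w) = law J (\<lambda>w. ((B w, C w), S w, U w)) ((B w, C w), S w, U w)"
      using markovD[OF markBS, of "(B w, C w)" "S w" "U w"] pos by (simp add: SU_def field_simps)
    also have "\<dots> \<le> law J (\<lambda>w. ((C w, U w), B w)) ((C w, U w), B w)"
      by (rule pmf_map_leI) auto
    finally have "law J ACB t * law J SU (S w, U w) / law J URS ((U w, R w), S w) \<le>
        law J (\<lambda>w. ((C w, U w), B w)) ((C w, U w), B w)"
      using 1 by simp
    then have "law J A (A w) * (law J Q (q (U w)) / law J U (U w) *
         (law J ACB t * law J SU (S w, U w) / law J URS ((U w, R w), S w))) \<le>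
       law J A (A w) * (law J Q (q (U w)) / law J U (U w) * law J (\<lambda>w. ((C w, U w), B w)) ((C w, U w), B w))"
      using pos by (intro mult_left_mono) auto
    then show ?thesis
      unfolding t \<phi>_def \<psi>_def by (simp add: u[OF w] s[OF w] \<rho>[OF w] ac_simps)
  qed
  have "(\<integral>\<^sup>+ w. ennreal (F w / G w) \<partial>measure_pmf J) = (\<integral>\<^sup>+ w. ennreal (\<phi> (ACB w)) \<partial>measure_pmf J)"
    by (intro nn_integral_cong_AE)
      (auto simp: AE_measure_pmf_iff F_def G_def \<phi>_def ACB_def u s \<rho> Q_def URS_def SU_def)
  also have "\<dots> = (\<integral>\<^sup>+ t. ennreal (\<phi> t) \<partial>measure_pmf (map_pmf ACB J))"
    by simp
  also have "\<dots> = (\<integral>\<^sup>+ t. ennreal (law J ACB t * \<phi> t) \<partial>count_space UNIV)"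
    unfolding nn_integral_measure_pmf by (simp add: ennreal_mult')
  also have "\<dots> \<le> (\<integral>\<^sup>+ t. ennreal (\<psi> t) \<partial>count_space UNIV)"
    by (intro nn_integral_mono ennreal_leI pointwise)
  also have "\<dots> = (\<integral>\<^sup>+ a. \<integral>\<^sup>+ c. \<integral>\<^sup>+ b. ennreal (\<psi> (a, c, b)) \<partial>count_space UNIV \<partial>count_space UNIV \<partial>count_space UNIV)"
    by (simp add: nn_integral_fst_count_space[symmetric])
  \<comment> \<open>Summing \<open>\<psi>\<close> over \<open>b\<close> turns its last factor into
    \<open>p(c,u)\<close>. By \<open>split\<close>, \<open>p(c,u) / p(u|q)\<close> is
    \<open>p(c,q)\<close>, at most \<open>p(c)\<close>. What remains is the product of the laws of
    \<open>A\<close> and \<open>C\<close>, of total mass 1.\<close>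
  also have "\<dots> \<le> (\<integral>\<^sup>+ a. \<integral>\<^sup>+ c. ennreal (law J A a) * ennreal (law J C c) \<partial>count_space UNIV \<partial>count_space UNIV)"
  proof (intro nn_integral_mono)
    fix a c
    let ?u = "u a c"
    have "law J Q (q ?u) / law J U ?u * law J (\<lambda>w. (C w, U w)) (c, ?u) \<le> law J C c"
    proof (cases "law J U ?u = 0")
      case False
      then have "law J Q (q ?u) / law J U ?u * law J (\<lambda>w. (C w, U w)) (c, ?u) = law J (\<lambda>w. (C w, q (U w))) (c, q ?u)"
        using split[of c ?u] by (simp add: Q_def[abs_def] field_simps)
      also have "\<dots> \<le> law J C c" by (rule pmf_map_leI) simp
      finally show ?thesis .
    qed simp
    moreover have "(\<integral>\<^sup>+ b. ennreal (\<psi> (a, c, b)) \<partial>count_space UNIV) =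
        ennreal (law J A a) * (ennreal (law J Q (q ?u) / law J U ?u) * ennreal (law J (\<lambda>w. (C w, U w)) (c, ?u)))"
      unfolding pmf_map_marginal[of "\<lambda>w. (C w, U w)" J _ B] \<psi>_def
      by (simp add: ennreal_mult' nn_integral_cmult del: times_divide_eq_left times_divide_eq_right)
    ultimately show "(\<integral>\<^sup>+ b. ennreal (\<psi> (a, c, b)) \<partial>count_space UNIV) \<le> ennreal (law J A a) * ennreal (law J C c)"
      by (simp only:) (intro mult_left_mono, simp_all add: ennreal_leI flip: ennreal_mult')
  qed
  also have "\<dots> = 1"
    by (simp add: nn_integral_cmult nn_integral_pmf measure_pmf.emeasure_space_1[simplified])
  finally have ratio: "(\<integral>\<^sup>+ w. ennreal (F w / G w) \<partial>measure_pmf J) \<le> 1" .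
  have "(\<integral>w. - log 2 (G w) \<partial>measure_pmf J) \<le> (\<integral>w. - log 2 (F w) \<partial>measure_pmf J)"
  proof (rule gibbs_inequality[OF _ Gpos _ intG ratio])
    show "integrable (measure_pmf J) (\<lambda>w. log 2 (F w))" using intF by simp
  qed (simp add: F_def pmf_map_pos)
  moreover have "resid_info (map_pmf SU J) + cond_ent (map_pmf URS J) \<le> (\<integral>w. - log 2 (G w) \<partial>measure_pmf J)"
    using common unfolding entG resid_info_def mutual_info_def cond_ent_def
    by (simp add: pmf.map_comp o_def SU_def URS_def)
  ultimately show ?thesis
    unfolding entF SU_def[symmetric] URS_def[symmetric] by (intro ennreal_leI) linarith
qed simp

section \<open>Symmetries of the entropy quantities\<close>

lemma ent_map_inj: "inj f \<Longrightarrow> ent (map_pmf f p) = ent p"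
  unfolding ent_def by (simp add: sum.reindex[OF inj_on_subset[OF _ subset_UNIV]] pmf_map_inj')

text \<open>The two sides of a common function agree on the support, so \<open>h\<close> and
  \<open>k\<close> can trade places without changing the entropy. Exchanging \<open>f\<close> and
  \<open>g\<close> gives the reverse inclusion.\<close>

lemma common_info_swap_subset:
  "{ent (map_pmf (\<lambda>(u, v). h u) (map_pmf (\<lambda>w. (f w, g w)) J)) | h k.
      \<forall>(u, v)\<in>set_pmf (map_pmf (\<lambda>w. (f w, g w)) J). (h u :: nat) = k v} \<subseteq>
    {ent (map_pmf (\<lambda>(u, v). h u) (map_pmf (\<lambda>w. (g w, f w)) J)) | h k.
      \<forall>(u, v)\<in>set_pmf (map_pmf (\<lambda>w. (g w, f w)) J). (h u :: nat) = k v}"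
proof clarify
  fix h k assume *: "\<forall>(u, v)\<in>set_pmf (map_pmf (\<lambda>w. (f w, g w)) J). (h u :: nat) = k v"
  then have "map_pmf (\<lambda>(u, v). h u) (map_pmf (\<lambda>w. (f w, g w)) J) = map_pmf (\<lambda>(u, v). k u) (map_pmf (\<lambda>w. (g w, f w)) J)"
    by (auto simp: pmf.map_comp o_def intro!: map_pmf_cong)
  then show "\<exists>h' k'. ent (map_pmf (\<lambda>(u, v). h u) (map_pmf (\<lambda>w. (f w, g w)) J)) =
      ent (map_pmf (\<lambda>(u, v). h' u) (map_pmf (\<lambda>w. (g w, f w)) J)) \<and>
      (\<forall>(u, v)\<in>set_pmf (map_pmf (\<lambda>w. (g w, f w)) J). (h' u :: nat) = k' v)"
    using * by (intro exI[of _ k] exI[of _ h]) auto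
qed

lemma resid_info_swap:
  "resid_info (map_pmf (\<lambda>w. (f w, g w)) J) = resid_info (map_pmf (\<lambda>w. (g w, f w)) J)"
proof -
  have "map_pmf (\<lambda>w. (f w, g w)) J = map_pmf prod.swap (map_pmf (\<lambda>w. (g w, f w)) J)"
    by (simp add: pmf.map_comp o_def)
  then have "ent (map_pmf (\<lambda>w. (f w, g w)) J) = ent (map_pmf (\<lambda>w. (g w, f w)) J)"
    by (simp only: ent_map_inj[OF inj_swap])
  moreover have "common_info (map_pmf (\<lambda>w. (f w, g w)) J) = common_info (map_pmf (\<lambda>w. (g w, f w)) J)"
    unfolding common_info_def by (intro arg_cong[of _ _ Sup] equalityI common_info_swap_subset)
  ultimately show ?thesis
    by (simp add: resid_info_def mutual_info_def pmf.map_comp o_def)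
qed

lemma cond_ent_swap:
  "cond_ent (map_pmf (\<lambda>w. ((f w, g w), h w)) J) = cond_ent (map_pmf (\<lambda>w. ((g w, f w), h w)) J)"
proof -
  have "map_pmf (\<lambda>w. ((f w, g w), h w)) J = map_pmf (\<lambda>((a, b), c). ((b, a), c)) (map_pmf (\<lambda>w. ((g w, f w), h w)) J)"
    by (simp add: pmf.map_comp o_def)
  also have "ent \<dots> = ent (map_pmf (\<lambda>w. ((g w, f w), h w)) J)"
    by (rule ent_map_inj) (auto simp: inj_def)
  finally show ?thesis by (simp add: cond_ent_def pmf.map_comp o_def)
qed

text \<open>With \<open>markR\<close> added, the hypotheses are invariant under exchanging
  \<open>U\<close> with \<open>R\<close> and \<open>C\<close> with \<open>B\<close>, and so is the
  conditional entropy. The two instances give the two terms of the maximum.\<close>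

lemma link_entropy_bound_max:
  fixes J :: "'w pmf" and U :: "'w \<Rightarrow> 'u::finite" and R :: "'w \<Rightarrow> 'r::finite" and S :: "'w \<Rightarrow> 's::finite"
  assumes detU: "\<And>v w. v \<in> set_pmf J \<Longrightarrow> w \<in> set_pmf J \<Longrightarrow> A v = A w \<Longrightarrow> C v = C w \<Longrightarrow> U v = U w"
    and detS: "\<And>v w. v \<in> set_pmf J \<Longrightarrow> w \<in> set_pmf J \<Longrightarrow> B v = B w \<Longrightarrow> C v = C w \<Longrightarrow> S v = S w"
    and detR: "\<And>v w. v \<in> set_pmf J \<Longrightarrow> w \<in> set_pmf J \<Longrightarrow> A v = A w \<Longrightarrow> B v = B w \<Longrightarrow> R v = R w"
    and markS: "markov J (\<lambda>w. (B w, C w)) S (\<lambda>w. (U w, R w))"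
    and markU: "markov J C U S" and markR: "markov J B R S"
  shows "ennreal (max (resid_info (map_pmf (\<lambda>w. (S w, U w)) J)) (resid_info (map_pmf (\<lambda>w. (S w, R w)) J))
      + cond_ent (map_pmf (\<lambda>w. ((U w, R w), S w)) J)) \<le> ent_inf (map_pmf A J)"
proof -
  have markS': "markov J (\<lambda>w. (C w, B w)) S (\<lambda>w. (R w, U w))"
    by (rule markov_comp[OF markS, where h = prod.swap and k = prod.swap]) auto
  have "ennreal (resid_info (map_pmf (\<lambda>w. (S w, U w)) J) + cond_ent (map_pmf (\<lambda>w. ((U w, R w), S w)) J))
      \<le> ent_inf (map_pmf A J)"
    by (rule link_entropy_bound[OF detU detS detR markS markU])
  moreover have "ennreal (resid_info (map_pmf (\<lambda>w. (S w, R w)) J) + cond_ent (map_pmf (\<lambda>w. ((U w, R w), S w)) J))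
      \<le> ent_inf (map_pmf A J)"
    unfolding cond_ent_swap[of U R S J]
    by (rule link_entropy_bound[OF detR detS detU markS' markR])
  ultimately show ?thesis by (auto simp: max_def)
qed

section \<open>Factorization of the transcript probabilities\<close>

lemma pmf_bind_single:
  assumes "\<And>x'. x' \<in> set_pmf M \<Longrightarrow> x' \<noteq> x \<Longrightarrow> pmf (f x') i = 0"
  shows "pmf (M \<bind> f) i = pmf M x * pmf (f x) i"
proof -
  have "pmf (M \<bind> f) i = (\<integral>x'. pmf (f x') i \<partial>measure_pmf M)" by (rule pmf_bind)
  also have "\<dots> = (\<Sum>x'\<in>{x}. pmf (f x') i * pmf M x')"
    using assms by (intro integral_measure_pmf_real) auto
  finally show ?thesis by simp
qed

section \<open>Unique decoding of link histories\<close>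

text \<open>\<open>g\<close> accumulates the rounds already read, because the code of a round
  depends on the earlier messages; its length is the round index.\<close>

primrec valid_hist :: "('x, 'y, 'z) protocol \<Rightarrow> nat \<Rightarrow> nat \<Rightarrow> hist \<Rightarrow> hist \<Rightarrow> bool" where
  "valid_hist P i j g [] \<longleftrightarrow> True"
| "valid_hist P i j g (uv # h) \<longleftrightarrow>
     fst uv \<in> code P i j (length g) g \<and> snd uv \<in> code P j i (length g) g \<and> valid_hist P i j (g @ [uv]) h"

lemma valid_hist_snoc:
  "valid_hist P i j g (h @ [uv]) \<longleftrightarrow> valid_hist P i j g h \<and>
     fst uv \<in> code P i j (length g + length h) (g @ h) \<and> snd uv \<in> code P j i (length g + length h) (g @ h)"
  by (induction h arbitrary: g) auto

text \<open>Two prefixes of one word are comparable, and comparable codewords of a prefix-free code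
  coincide.\<close>

lemma prefix_free_append_eq:
  assumes "prefix_free C" "u \<in> C" "u' \<in> C" "u @ v = u' @ v'"
  shows "u = u' \<and> v = v'"
proof -
  have "prefix u u' \<or> prefix u' u"
    using assms(4) by (metis prefixI prefix_same_cases)
  then have "u = u'" using assms(1-3) unfolding prefix_free_def by blast
  then show ?thesis using assms(4) by simp
qed

text \<open>Decoding proceeds round by round: the histories agree so far, hence the next words come
  from the same codes. Equal lengths are required since rounds of empty words leave no trace in
  \<open>flat\<close>.\<close>

lemma valid_hist_flat_inj:
  assumes "\<And>i j t h. prefix_free (code P i j t h)"
    and "valid_hist P i j g h" "valid_hist P i j g h'" "length h = length h'" "flat h = flat h'"
  shows "h = h'"
  using assms(2-)
proof (induction h arbitrary: g h')
  case (Cons uv h)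
  obtain u v where uv: "uv = (u, v)" by fastforce
  obtain u' v' k where h': "h' = (u', v') # k" using Cons.prems(3) by (cases h') auto
  have eq: "u @ v @ flat h = u' @ v' @ flat k"
    using Cons.prems(4) by (simp add: flat_def uv h')
  have 1: "u = u' \<and> v @ flat h = v' @ flat k"
    using prefix_free_append_eq[OF assms(1)[of i j "length g" g] _ _ eq] Cons.prems(1,2) by (simp add: uv h')
  have 2: "v = v' \<and> flat h = flat k"
    using prefix_free_append_eq[OF assms(1)[of j i "length g" g] _ _ conjunct2[OF 1]] Cons.prems(1,2) by (simp add: uv h')
  have "h = k"
    using Cons.IH[of "g @ [uv]" k] Cons.prems 1 2 by (simp add: uv h')
  then show ?case using 1 2 by (simp add: uv h')
qed simp

lemma exec_valid_hist:
  assumes "valid_protocol P" "(h12, h23, h31) \<in> set_pmf (exec P x y n)"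
  shows "length h12 = n \<and> length h23 = n \<and> length h31 = n \<and>
    valid_hist P 1 2 [] h12 \<and> valid_hist P 2 3 [] h23 \<and> valid_hist P 3 1 [] h31"
  using assms(2)
proof (induction n arbitrary: h12 h23 h31)
  case (Suc n)
  then obtain g12 g23 g31 a2 a3 b1 b3 c1 c2 where
    g: "(g12, g23, g31) \<in> set_pmf (exec P x y n)" and
    a: "(a2, a3) \<in> set_pmf (party1 P n x g12 g31)" and
    b: "(b1, b3) \<in> set_pmf (party2 P n y g12 g23)" and
    c: "(c1, c2) \<in> set_pmf (party3 P n g23 g31)" and
    h: "h12 = g12 @ [(a2, b1)]" "h23 = g23 @ [(b3, c2)]" "h31 = g31 @ [(c1, a3)]"
    by (auto simp: set_bind_pmf)
  show ?case
    using Suc.IH[OF g] a b c assms(1) unfolding h valid_protocol_def valid_hist_snoc by auto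
qed simp

text \<open>The extended history reveals the old history and all six messages, so each bind has a
  single contributing outcome.\<close>

lemma exec_Suc_pmf:
  "pmf (exec P x y (Suc n)) (g12 @ [(a2, b1)], g23 @ [(b3, c2)], g31 @ [(c1, a3)]) =
    pmf (exec P x y n) (g12, g23, g31) * (pmf (party1 P n x g12 g31) (a2, a3) *
      (pmf (party2 P n y g12 g23) (b1, b3) * pmf (party3 P n g23 g31) (c1, c2)))"
proof -
  have zero: "pmf (party1 P n x h12 h31 \<bind> (\<lambda>(a2, a3).
       party2 P n y h12 h23 \<bind> (\<lambda>(b1, b3).
       party3 P n h23 h31 \<bind> (\<lambda>(c1, c2).
       return_pmf (h12 @ [(a2, b1)], h23 @ [(b3, c2)], h31 @ [(c1, a3)])))))
       (g12 @ [(a2, b1)], g23 @ [(b3, c2)], g31 @ [(c1, a3)]) = 0"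
    if "(h12, h23, h31) \<noteq> (g12, g23, g31)" for h12 h23 h31
    using that by (auto simp: pmf_eq_0_set_pmf set_bind_pmf)
  have zero1: "pmf (party2 P n y g12 g23 \<bind> (\<lambda>(b1, b3).
       party3 P n g23 g31 \<bind> (\<lambda>(c1, c2).
       return_pmf (g12 @ [(a2', b1)], g23 @ [(b3, c2)], g31 @ [(c1, a3')]))))
       (g12 @ [(a2, b1)], g23 @ [(b3, c2)], g31 @ [(c1, a3)]) = 0"
    if "(a2', a3') \<noteq> (a2, a3)" for a2' a3'
    using that by (auto simp: pmf_eq_0_set_pmf set_bind_pmf)
  have zero2: "pmf (party3 P n g23 g31 \<bind> (\<lambda>(c1, c2).
       return_pmf (g12 @ [(a2, b1')], g23 @ [(b3', c2)], g31 @ [(c1, a3)])))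
       (g12 @ [(a2, b1)], g23 @ [(b3, c2)], g31 @ [(c1, a3)]) = 0"
    if "(b1', b3') \<noteq> (b1, b3)" for b1' b3'
    using that by (auto simp: pmf_eq_0_set_pmf set_bind_pmf)
  show ?thesis
    unfolding exec.simps
    apply (subst pmf_bind_single[of _ "(g12, g23, g31)"])
     apply (use zero in auto)[1]
    apply (simp only: prod.case)
    apply (subst pmf_bind_single[of _ "(a2, a3)"])
     apply (use zero1 in auto)[1]
    apply (simp only: prod.case)
    apply (subst pmf_bind_single[of _ "(b1, b3)"])
     apply (use zero2 in auto)[1]
    apply (simp only: prod.case)
    apply (subst pmf_bind_single[of _ "(c1, c2)"])
     apply (auto simp: indicator_def split: if_splits)
    done
qed

text \<open>Given the past, the parties randomize independently. Each round therefore contributes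
  one factor per party, depending only on that party's input and its own two links.\<close>

lemma exec_factorization:
  "\<exists>\<alpha> \<beta> \<gamma>. \<forall>x y h12 h23 h31. pmf (exec P x y n) (h12, h23, h31) = \<alpha> x h12 h31 * \<beta> y h12 h23 * \<gamma> h23 h31"
proof (induction n)
  case 0
  show ?case
    by (rule exI[of _ "\<lambda>x h k. of_bool (h = [] \<and> k = [])"], rule exI[of _ "\<lambda>x h k. of_bool (h = [] \<and> k = [])"],
        rule exI[of _ "\<lambda>h k. of_bool (h = [] \<and> k = [])"]) (auto simp: indicator_def)
next
  case (Suc n)
  then obtain \<alpha> \<beta> \<gamma> where IH: "\<And>x y h12 h23 h31.
      pmf (exec P x y n) (h12, h23, h31) = \<alpha> x h12 h31 * \<beta> y h12 h23 * \<gamma> h23 h31"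
    by blast
  \<comment> \<open>\<open>butlast\<close> and \<open>last\<close> undo a round only on nonempty
    lists. The indicators in \<open>\<alpha>'\<close> and \<open>\<beta>'\<close> together cover all
    three links and give the correct value zero if some history is empty.\<close>
  define \<alpha>' where "\<alpha>' = (\<lambda>x h12 h31. of_bool (h12 \<noteq> [] \<and> h31 \<noteq> []) * \<alpha> x (butlast h12) (butlast h31) *
      pmf (party1 P n x (butlast h12) (butlast h31)) (fst (last h12), snd (last h31)))"
  define \<beta>' where "\<beta>' = (\<lambda>y h12 h23. of_bool (h12 \<noteq> [] \<and> h23 \<noteq> []) * \<beta> y (butlast h12) (butlast h23) *
      pmf (party2 P n y (butlast h12) (butlast h23)) (snd (last h12), fst (last h23)))"
  define \<gamma>' where "\<gamma>' = (\<lambda>h23 h31. \<gamma> (butlast h23) (butlast h31) *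
      pmf (party3 P n (butlast h23) (butlast h31)) (fst (last h31), snd (last h23)))"
  have "pmf (exec P x y (Suc n)) (h12, h23, h31) = \<alpha>' x h12 h31 * \<beta>' y h12 h23 * \<gamma>' h23 h31"
    for x y h12 h23 h31
  proof (cases "h12 = [] \<or> h23 = [] \<or> h31 = []")
    case True
    then have "pmf (exec P x y (Suc n)) (h12, h23, h31) = 0"
      by (auto simp: pmf_eq_0_set_pmf set_bind_pmf)
    then show ?thesis using True by (auto simp: \<alpha>'_def \<beta>'_def)
  next
    case False
    then obtain g12 a2 b1 g23 b3 c2 g31 c1 a3 where
      "h12 = g12 @ [(a2, b1)]" "h23 = g23 @ [(b3, c2)]" "h31 = g31 @ [(c1, a3)]"
      by (metis append_butlast_last_id surj_pair)
    then show ?thesis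
      by (simp only: exec_Suc_pmf IH) (simp add: \<alpha>'_def \<beta>'_def \<gamma>'_def)
  qed
  then show ?case by blast
qed

text \<open>Each link is decoded on its own, so \<open>\<alpha>\<close> still sees only Alice's
  links and \<open>\<beta>\<close> only Bob's. \<open>\<gamma>\<close> receives all three
  transcripts because it absorbs the termination test, which is free of the inputs.\<close>

lemma transcript_prob_factorization:
  assumes "valid_protocol P"
  shows "\<exists>\<alpha> \<beta> \<gamma>. \<forall>x y m12 m23 m31.
    measure_pmf.prob (exec P x y n) {s. finished P n s \<and> transcripts s = (m12, m23, m31)} =
    \<alpha> x m12 m31 * \<beta> y m12 m23 * \<gamma> m12 m23 m31"
proof -
  obtain \<alpha> \<beta> \<gamma> where fac: "\<And>x y h12 h23 h31.
      pmf (exec P x y n) (h12, h23, h31) = \<alpha> x h12 h31 * \<beta> y h12 h23 * \<gamma> h23 h31"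
    using exec_factorization by metis
  have pf: "\<And>i j t h. prefix_free (code P i j t h)"
    using assms by (simp add: valid_protocol_def)
  define d where "d = (\<lambda>i j m. SOME h. valid_hist P i j [] h \<and> length h = n \<and> flat h = m)"
  have d: "d i j (flat h) = h" if "valid_hist P i j [] h" "length h = n" for i j h
  proof -
    have "\<exists>h'. valid_hist P i j [] h' \<and> length h' = n \<and> flat h' = flat h" using that by blast
    then have "valid_hist P i j [] (d i j (flat h)) \<and> length (d i j (flat h)) = n \<and> flat (d i j (flat h)) = flat h"
      unfolding d_def by (rule someI_ex)
    then show ?thesis using valid_hist_flat_inj[OF pf, of i j "[]"] that by metis
  qed
  have "measure_pmf.prob (exec P x y n) {s. finished P n s \<and> transcripts s = (m12, m23, m31)} =
     \<alpha> x (d 1 2 m12) (d 3 1 m31) * \<beta> y (d 1 2 m12) (d 2 3 m23) *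
     (\<gamma> (d 2 3 m23) (d 3 1 m31) * of_bool (finished P n (d 1 2 m12, d 2 3 m23, d 3 1 m31) \<and>
        transcripts (d 1 2 m12, d 2 3 m23, d 3 1 m31) = (m12, m23, m31)))"
    (is "measure_pmf.prob ?M ?E = _") for x y m12 m23 m31
  proof -
    let ?D = "(d 1 2 m12, d 2 3 m23, d 3 1 m31)"
    \<comment> \<open>Unique decoding leaves at most the point \<open>?D\<close> of the support in
      the event; \<open>of_bool\<close> records whether \<open>?D\<close> belongs to it.\<close>
    have "s = ?D" if "s \<in> set_pmf ?M" "transcripts s = (m12, m23, m31)" for s
    proof -
      obtain h12 h23 h31 where s: "s = (h12, h23, h31)" by (cases s)
      show ?thesis
        using exec_valid_hist[OF assms that(1)[unfolded s]] that(2) d unfolding s transcripts_def by auto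
    qed
    then have "measure_pmf.prob ?M ?E = measure_pmf.prob ?M (if ?D \<in> ?E then {?D} else {})"
      by (intro measure_pmf.finite_measure_eq_AE) (auto simp: AE_measure_pmf_iff)
    then show ?thesis by (simp add: measure_pmf_single fac)
  qed
  then show ?thesis
    by (intro exI[of _ "\<lambda>x m12 m31. \<alpha> x (d 1 2 m12) (d 3 1 m31)"]
        exI[of _ "\<lambda>y m12 m23. \<beta> y (d 1 2 m12) (d 2 3 m23)"]
        exI[of _ "\<lambda>m12 m23 m31. \<gamma> (d 2 3 m23) (d 3 1 m31) * of_bool (finished P n (d 1 2 m12, d 2 3 m23, d 3 1 m31) \<and>
        transcripts (d 1 2 m12, d 2 3 m23, d 3 1 m31) = (m12, m23, m31))"]) blast
qed

text \<open>For each \<open>n\<close>, swapping \<open>m23\<close> and \<open>n23\<close> only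
  permutes the factors of the two factorized probabilities. The product identity passes to the limit
  without any claim that the individual factors converge.\<close>

lemma transcript_exchange_Alice:
  assumes "valid_protocol P" "is_transcript_dist P x y q" "is_transcript_dist P x' y q'"
  shows "pmf q (m12, m23, m31) * pmf q' (m12, n23, m31) = pmf q (m12, n23, m31) * pmf q' (m12, m23, m31)"
proof -
  define E where "E x y n m = measure_pmf.prob (exec P x y n) {s. finished P n s \<and> transcripts s = m}" for x y n m
  have lim: "(\<lambda>n. E x y n m) \<longlonglongrightarrow> pmf q m" "(\<lambda>n. E x' y n m) \<longlonglongrightarrow> pmf q' m" for m
    unfolding E_def by (rule assms(2,3)[unfolded is_transcript_dist_def, rule_format])+
  have "E x y n (m12, m23, m31) * E x' y n (m12, n23, m31) = E x y n (m12, n23, m31) * E x' y n (m12, m23, m31)" for n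
  proof -
    obtain \<alpha> \<beta> \<gamma> where "\<forall>x y m12 m23 m31. E x y n (m12, m23, m31) = \<alpha> x m12 m31 * \<beta> y m12 m23 * \<gamma> m12 m23 m31"
      using transcript_prob_factorization[OF assms(1), of n] unfolding E_def by (elim exE)
    then show ?thesis by simp
  qed
  with tendsto_mult[OF lim(1)[of "(m12, m23, m31)"] lim(2)[of "(m12, n23, m31)"]]
  have "(\<lambda>n. E x y n (m12, n23, m31) * E x' y n (m12, m23, m31)) \<longlonglongrightarrow> pmf q (m12, m23, m31) * pmf q' (m12, n23, m31)"
    by simp
  from LIMSEQ_unique[OF this tendsto_mult[OF lim]] show ?thesis .
qed

text \<open>The same permutation of factors, now with Bob's input changing and the Charlie-Alice
  transcript being swapped.\<close>

lemma transcript_exchange_Bob: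
  assumes "valid_protocol P" "is_transcript_dist P x y q" "is_transcript_dist P x y' q'"
  shows "pmf q (m12, m23, m31) * pmf q' (m12, m23, n31) = pmf q (m12, m23, n31) * pmf q' (m12, m23, m31)"
proof -
  define E where "E x y n m = measure_pmf.prob (exec P x y n) {s. finished P n s \<and> transcripts s = m}" for x y n m
  have lim: "(\<lambda>n. E x y n m) \<longlonglongrightarrow> pmf q m" "(\<lambda>n. E x y' n m) \<longlonglongrightarrow> pmf q' m" for m
    unfolding E_def by (rule assms(2,3)[unfolded is_transcript_dist_def, rule_format])+
  have "E x y n (m12, m23, m31) * E x y' n (m12, m23, n31) = E x y n (m12, m23, n31) * E x y' n (m12, m23, m31)" for n
  proof -
    obtain \<alpha> \<beta> \<gamma> where "\<forall>x y m12 m23 m31. E x y n (m12, m23, m31) = \<alpha> x m12 m31 * \<beta> y m12 m23 * \<gamma> m12 m23 m31"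
      using transcript_prob_factorization[OF assms(1), of n] unfolding E_def by (elim exE)
    then show ?thesis by simp
  qed
  with tendsto_mult[OF lim(1)[of "(m12, m23, m31)"] lim(2)[of "(m12, m23, n31)"]]
  have "(\<lambda>n. E x y n (m12, m23, n31) * E x y' n (m12, m23, m31)) \<longlonglongrightarrow> pmf q (m12, m23, m31) * pmf q' (m12, m23, n31)"
    by simp
  from LIMSEQ_unique[OF this tendsto_mult[OF lim]] show ?thesis .
qed

section \<open>Views determine inputs and output\<close>

text \<open>The hypothesis says that \<open>q\<close> and \<open>q'\<close> are proportional on each fibre of \<open>v\<close>; it is
  cross-multiplied so that vanishing weights need no case distinction.\<close>

lemma pmf_bind_exchange:
  assumes "\<And>m m'. v m = v m' \<Longrightarrow> pmf q m * pmf q' m' = pmf q m' * pmf q' m"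
  shows "pmf (q \<bind> (\<lambda>m. map_pmf (Pair (v m)) (out m))) (a, z) *
      pmf (q' \<bind> (\<lambda>m. map_pmf (Pair (v m)) (out m))) (a, z') =
    pmf (q \<bind> (\<lambda>m. map_pmf (Pair (v m)) (out m))) (a, z') *
      pmf (q' \<bind> (\<lambda>m. map_pmf (Pair (v m)) (out m))) (a, z)"
proof -
  define g where "g z m = pmf (map_pmf (Pair (v m)) (out m)) (a, z)" for z m
  have g0: "g z m = 0" if "v m \<noteq> a" for z m
    using that by (auto simp: g_def pmf_eq_0_set_pmf)
  have e: "ennreal (pmf (q \<bind> (\<lambda>m. map_pmf (Pair (v m)) (out m))) (a, z)) =
      (\<integral>\<^sup>+ m. ennreal (pmf q m * g z m) \<partial>count_space UNIV)" for q z
    unfolding ennreal_pmf_bind nn_integral_measure_pmf by (simp add: g_def ennreal_mult)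
  have "ennreal (pmf (q \<bind> (\<lambda>m. map_pmf (Pair (v m)) (out m))) (a, z)) *
      ennreal (pmf (q' \<bind> (\<lambda>m. map_pmf (Pair (v m)) (out m))) (a, z')) =
     (\<integral>\<^sup>+ m. \<integral>\<^sup>+ m'. ennreal (pmf q m * g z m) * ennreal (pmf q' m' * g z' m') \<partial>count_space UNIV \<partial>count_space UNIV)"
    unfolding e by (simp add: nn_integral_cmult nn_integral_multc)
  also have "\<dots> =
     (\<integral>\<^sup>+ m. \<integral>\<^sup>+ m'. ennreal (pmf q' m * g z m) * ennreal (pmf q m' * g z' m') \<partial>count_space UNIV \<partial>count_space UNIV)"
  \<comment> \<open>Terms off the fibre over \<open>a\<close> vanish with \<open>g\<close>; on it
    the hypothesis trades the weights of \<open>q\<close> and \<open>q'\<close>.\<close>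
  proof (intro nn_integral_cong)
    fix m m'
    have "pmf q m * g z m * (pmf q' m' * g z' m') = pmf q' m * g z m * (pmf q m' * g z' m')"
    proof (cases "v m = a \<and> v m' = a")
      case True
      then have "pmf q m * pmf q' m' = pmf q m' * pmf q' m" using assms by simp
      then have "(pmf q m * pmf q' m') * (g z m * g z' m') = (pmf q m' * pmf q' m) * (g z m * g z' m')"
        by (rule arg_cong)
      then show ?thesis by (simp add: ac_simps)
    qed (auto simp: g0)
    then show "ennreal (pmf q m * g z m) * ennreal (pmf q' m' * g z' m') =
        ennreal (pmf q' m * g z m) * ennreal (pmf q m' * g z' m')"
      by (simp add: g_def flip: ennreal_mult)
  qed
  also have "\<dots> = ennreal (pmf (q \<bind> (\<lambda>m. map_pmf (Pair (v m)) (out m))) (a, z')) *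
      ennreal (pmf (q' \<bind> (\<lambda>m. map_pmf (Pair (v m)) (out m))) (a, z))"
    unfolding e by (simp add: nn_integral_cmult nn_integral_multc mult.commute)
  finally show ?thesis by (simp flip: ennreal_mult)
qed

text \<open>Up to constants \<open>f\<close> and \<open>f'\<close> stand for \<open>p\<close> and
  \<open>p'\<close>. The exchange rule makes \<open>p\<close> and \<open>p'\<close> proportional,
  and total mass 1 makes them equal.\<close>

lemma pmf_eqI_exchange:
  fixes p p' :: "'z::finite pmf" and f f' :: "'z \<Rightarrow> real"
  assumes f: "\<And>z. f z * c = k * pmf p z" and f': "\<And>z. f' z * c' = k' * pmf p' z"
    and k: "k > 0" "k' > 0" and exch: "\<And>z z'. f z * f' z' = f z' * f' z"
  shows "p = p'"
proof (rule pmf_eqI)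
  fix z
  have "pmf p z * pmf p' z' = pmf p z' * pmf p' z" for z'
  proof -
    have "(k * k') * (pmf p z * pmf p' z') = (f z * f' z') * (c * c')"
      using f[of z] f'[of z'] by (simp add: ac_simps)
    also have "\<dots> = (f z' * f' z) * (c * c')" by (simp only: exch)
    also have "\<dots> = (k * k') * (pmf p z' * pmf p' z)"
      using f[of z'] f'[of z] by (simp add: ac_simps)
    finally show ?thesis using k by simp
  qed
  then have "(\<Sum>z'\<in>UNIV. pmf p z * pmf p' z') = (\<Sum>z'\<in>UNIV. pmf p z' * pmf p' z)"
    by (intro sum.cong) simp_all
  then show "pmf p z = pmf p' z"
    by (simp add: sum_pmf_eq_1 flip: sum_distrib_left sum_distrib_right)
qed

text \<open>One notion serves all parties: \<open>v\<close> selects a party's two transcripts, and a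
  constant \<open>v\<close> leaves just the output law.\<close>

definition view_output ::
  "(bool list \<times> bool list \<times> bool list \<Rightarrow> 'v) \<Rightarrow> ('x, 'y, 'z) protocol \<Rightarrow>
   (bool list \<times> bool list \<times> bool list) pmf \<Rightarrow> ('v \<times> 'z) pmf" where
  "view_output v P q = q \<bind> (\<lambda>m. map_pmf (Pair (v m)) (output3 P (fst (snd m)) (snd (snd m))))"

lemma law_joint_view:
  "law (joint pXY P Q) (\<lambda>(x, y, z, m). (v m, x, y, z)) (a, x, y, z) =
    pmf pXY (x, y) * pmf (view_output v P (Q x y)) (a, z)"
proof -
  have "map_pmf (\<lambda>(x, y, z, m). (v m, x, y, z)) (joint pXY P Q) =
      pXY \<bind> (\<lambda>xy. map_pmf (\<lambda>(a, z). (a, fst xy, snd xy, z)) (view_output v P (Q (fst xy) (snd xy))))"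
    unfolding joint_def view_output_def map_bind_pmf
    by (intro bind_pmf_cong refl)
      (auto simp: map_bind_pmf map_pmf_def bind_assoc_pmf bind_return_pmf split: prod.split intro!: bind_pmf_cong)
  also have "pmf \<dots> (a, x, y, z) = pmf pXY (x, y) *
      pmf (map_pmf (\<lambda>(a, z). (a, x, y, z)) (view_output v P (Q x y))) (a, x, y, z)"
    by (subst pmf_bind_single[of _ "(x, y)"]) (auto simp: pmf_eq_0_set_pmf)
  also have "pmf (map_pmf (\<lambda>(a, z). (a, x, y, z)) (view_output v P (Q x y))) (a, x, y, z) =
      pmf (map_pmf (\<lambda>(a, z). (a, x, y, z)) (view_output v P (Q x y))) ((\<lambda>(a, z). (a, x, y, z)) (a, z))"
    by simp
  also have "\<dots> = pmf (view_output v P (Q x y)) (a, z)"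
    by (rule pmf_map_inj') (auto simp: inj_def)
  finally show ?thesis .
qed

section \<open>Consequences of correctness and privacy\<close>

context
  fixes pXY :: "('x::finite \<times> 'y::finite) pmf"
    and pZ :: "'x \<Rightarrow> 'y \<Rightarrow> 'z::finite pmf"
    and P :: "('x, 'y, 'z) protocol"
    and Q :: "'x \<Rightarrow> 'y \<Rightarrow> (bool list \<times> bool list \<times> bool list) pmf"
  assumes normal: "normal_form pXY pZ"
    and secure: "secure_protocol pXY pZ P Q"
begin

lemma secure_valid: "valid_protocol P"
  using secure unfolding secure_protocol_def by blast

lemma secure_transcript_dist: "pmf pXY (x, y) > 0 \<Longrightarrow> is_transcript_dist P x y (Q x y)"
  using secure unfolding secure_protocol_def by blast

lemma secure_privacy:
  "markov (joint pXY P Q) (\<lambda>(x, y, z, m12, m23, m31). (m12, m31)) (\<lambda>(x, y, z, m). x) (\<lambda>(x, y, z, m). (y, z))"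
  "markov (joint pXY P Q) (\<lambda>(x, y, z, m12, m23, m31). (m12, m23)) (\<lambda>(x, y, z, m). y) (\<lambda>(x, y, z, m). (x, z))"
  "markov (joint pXY P Q) (\<lambda>(x, y, z, m12, m23, m31). (m23, m31)) (\<lambda>(x, y, z, m). z) (\<lambda>(x, y, z, m). (x, y))"
  using secure unfolding secure_protocol_def Let_def by blast+

text \<open>Correctness of the protocol, read off from \<open>law_joint_view\<close> at the constant
  view.\<close>

lemma law_xyz:
  assumes "pmf pXY (x, y) > 0"
  shows "law (joint pXY P Q) (\<lambda>(x, y, z, m). (x, y, z)) (x, y, z) = pmf pXY (x, y) * pmf (pZ x y) z"
proof -
  have "view_output (\<lambda>_. ()) P (Q x y) = map_pmf (Pair ()) (Q x y \<bind> (\<lambda>(m12, m23, m31). output3 P m23 m31))"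
    by (simp add: view_output_def map_bind_pmf case_prod_unfold)
  also have "Q x y \<bind> (\<lambda>(m12, m23, m31). output3 P m23 m31) = pZ x y"
    using secure assms unfolding secure_protocol_def by blast
  finally have "view_output (\<lambda>_. ()) P (Q x y) = map_pmf (Pair ()) (pZ x y)" .
  then have "pmf (view_output (\<lambda>_. ()) P (Q x y)) ((), z) = pmf (pZ x y) z"
    by (simp add: pmf_map_inj' inj_def)
  moreover have "law (joint pXY P Q) (\<lambda>(x, y, z, m). (x, y, z)) (x, y, z) =
      law (joint pXY P Q) (\<lambda>(x, y, z, m). ((\<lambda>_. ()) m, x, y, z)) ((), x, y, z)"
    by (rule pmf_map_eqI) auto
  ultimately show ?thesis by (simp only: law_joint_view)
qed

text \<open>Privacy makes Alice's view independent of \<open>(y, z)\<close> given \<open>x\<close>,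
  so view and output together have probability \<open>p(a|x) p(z|x,y)\<close>. The weight
  \<open>pmf pXY (x, y)\<close> cancels from the Markov identity.\<close>

lemma view_output_Alice:
  assumes "pmf pXY (x, y) > 0"
  shows "pmf (view_output (\<lambda>(m12, m23, m31). (m12, m31)) P (Q x y)) (a, z) *
      law (joint pXY P Q) (\<lambda>(x, y, z, m). x) x =
    law (joint pXY P Q) (\<lambda>(x, y, z, m12, m23, m31). ((m12, m31), x)) (a, x) * pmf (pZ x y) z"
proof -
  let ?J = "joint pXY P Q"
  have "law ?J (\<lambda>w. ((\<lambda>(x, y, z, m12, m23, m31). (m12, m31)) w, (\<lambda>(x, y, z, m). x) w, (\<lambda>(x, y, z, m). (y, z)) w)) (a, x, y, z)
     = law ?J (\<lambda>(x, y, z, m). ((\<lambda>(m12, m23, m31). (m12, m31)) m, x, y, z)) (a, x, y, z)"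
    "law ?J (\<lambda>w. ((\<lambda>(x, y, z, m). x) w, (\<lambda>(x, y, z, m). (y, z)) w)) (x, y, z) = law ?J (\<lambda>(x, y, z, m). (x, y, z)) (x, y, z)"
    "law ?J (\<lambda>w. ((\<lambda>(x, y, z, m12, m23, m31). (m12, m31)) w, (\<lambda>(x, y, z, m). x) w)) (a, x) =
      law ?J (\<lambda>(x, y, z, m12, m23, m31). ((m12, m31), x)) (a, x)"
    by (rule pmf_map_eqI, auto)+
  with markovD[OF secure_privacy(1), of a x "(y, z)"] law_xyz[OF assms] assms show ?thesis
    by (simp add: law_joint_view)
qed

lemma view_output_Bob:
  assumes "pmf pXY (x, y) > 0"
  shows "pmf (view_output (\<lambda>(m12, m23, m31). (m12, m23)) P (Q x y)) (a, z) *
      law (joint pXY P Q) (\<lambda>(x, y, z, m). y) y =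
    law (joint pXY P Q) (\<lambda>(x, y, z, m12, m23, m31). ((m12, m23), y)) (a, y) * pmf (pZ x y) z"
proof -
  let ?J = "joint pXY P Q"
  have "law ?J (\<lambda>w. ((\<lambda>(x, y, z, m12, m23, m31). (m12, m23)) w, (\<lambda>(x, y, z, m). y) w, (\<lambda>(x, y, z, m). (x, z)) w)) (a, y, x, z)
     = law ?J (\<lambda>(x, y, z, m). ((\<lambda>(m12, m23, m31). (m12, m23)) m, x, y, z)) (a, x, y, z)"
    "law ?J (\<lambda>w. ((\<lambda>(x, y, z, m). y) w, (\<lambda>(x, y, z, m). (x, z)) w)) (y, x, z) = law ?J (\<lambda>(x, y, z, m). (x, y, z)) (x, y, z)"
    "law ?J (\<lambda>w. ((\<lambda>(x, y, z, m12, m23, m31). (m12, m23)) w, (\<lambda>(x, y, z, m). y) w)) (a, y) =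
      law ?J (\<lambda>(x, y, z, m12, m23, m31). ((m12, m23), y)) (a, y)"
    by (rule pmf_map_eqI, auto)+
  with markovD[OF secure_privacy(2), of a y "(x, z)"] law_xyz[OF assms] assms show ?thesis
    by (simp add: law_joint_view)
qed

text \<open>The law of \<open>z\<close> and the joint law of view and \<open>z\<close> do not
  involve \<open>(x, y)\<close>; this later makes the constant in \<open>equiv_z\<close> uniform in
  the inputs.\<close>

lemma view_output_Charlie:
  assumes "pmf pXY (x, y) > 0"
  shows "pmf (view_output snd P (Q x y)) (a, z) *
      law (joint pXY P Q) (\<lambda>(x, y, z, m). z) z =
    law (joint pXY P Q) (\<lambda>(x, y, z, m12, m23, m31). ((m23, m31), z)) (a, z) * pmf (pZ x y) z"
proof -
  let ?J = "joint pXY P Q"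
  have "law ?J (\<lambda>w. ((\<lambda>(x, y, z, m12, m23, m31). (m23, m31)) w, (\<lambda>(x, y, z, m). z) w, (\<lambda>(x, y, z, m). (x, y)) w)) (a, z, x, y)
     = law ?J (\<lambda>(x, y, z, m). (snd m, x, y, z)) (a, x, y, z)"
    "law ?J (\<lambda>w. ((\<lambda>(x, y, z, m). z) w, (\<lambda>(x, y, z, m). (x, y)) w)) (z, x, y) = law ?J (\<lambda>(x, y, z, m). (x, y, z)) (x, y, z)"
    "law ?J (\<lambda>w. ((\<lambda>(x, y, z, m12, m23, m31). (m23, m31)) w, (\<lambda>(x, y, z, m). z) w)) (a, z) =
      law ?J (\<lambda>(x, y, z, m12, m23, m31). ((m23, m31), z)) (a, z)"
    by (rule pmf_map_eqI, auto)+
  with markovD[OF secure_privacy(3), of a z "(x, y)"] law_xyz[OF assms] assms show ?thesis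
    by (simp add: law_joint_view)
qed

text \<open>Fix \<open>y0\<close> compatible with both inputs. The view has positive probability
  together with either input. On it the exchange rule makes the two output laws proportional, and
  privacy identifies them with \<open>pZ x y0\<close> and \<open>pZ x' y0\<close>. If there is no
  such \<open>y0\<close>, then \<open>equiv_x\<close> holds vacuously.\<close>

lemma Alice_view_determines_input:
  assumes w: "(x, y, z, m12, m23, m31) \<in> set_pmf (joint pXY P Q)"
    and w': "(x', y', z', m12, m23', m31) \<in> set_pmf (joint pXY P Q)"
  shows "x = x'"
proof -
  let ?v = "\<lambda>(m12, m23, m31). (m12, m31)"
  have "pZ x y0 = pZ x' y0" if y0: "y0 \<in> S_set pXY x x'" for y0
  proof -
    have pos: "pmf pXY (x, y0) > 0" "pmf pXY (x', y0) > 0"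
      using y0 by (auto simp: S_set_def)
    show ?thesis
    proof (rule pmf_eqI_exchange[OF view_output_Alice[OF pos(1), of "(m12, m31)"]
          view_output_Alice[OF pos(2), of "(m12, m31)"]])
      show "law (joint pXY P Q) (\<lambda>(x, y, z, m12, m23, m31). ((m12, m31), x)) ((m12, m31), x) > 0"
        "law (joint pXY P Q) (\<lambda>(x, y, z, m12, m23, m31). ((m12, m31), x)) ((m12, m31), x') > 0"
        using w w' by (force intro!: pmf_positive)+
      show "pmf (view_output ?v P (Q x y0)) ((m12, m31), t) * pmf (view_output ?v P (Q x' y0)) ((m12, m31), t') =
        pmf (view_output ?v P (Q x y0)) ((m12, m31), t') * pmf (view_output ?v P (Q x' y0)) ((m12, m31), t)" for t t'
        unfolding view_output_def
      proof (rule pmf_bind_exchange)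
        fix m n :: "bool list \<times> bool list \<times> bool list" assume "?v m = ?v n"
        then obtain a b c b' where "m = (a, b, c)" "n = (a, b', c)"
          by (cases m, cases n) auto
        then show "pmf (Q x y0) m * pmf (Q x' y0) n = pmf (Q x y0) n * pmf (Q x' y0) m"
          by (simp only:) (rule transcript_exchange_Alice[OF secure_valid secure_transcript_dist[OF pos(1)] secure_transcript_dist[OF pos(2)]])
      qed
    qed
  qed
  then have "equiv_x pXY pZ x x'" unfolding equiv_x_def by simp
  then show ?thesis by (rule normal[unfolded normal_form_def, THEN conjunct1, rule_format])
qed

text \<open>The argument for Alice with the inputs exchanged: \<open>x0\<close> is held fixed, and
  \<open>transcript_exchange_Bob\<close> varies the transcript hidden from Bob.\<close>

lemma Bob_view_determines_input:
  assumes w: "(x, y, z, m12, m23, m31) \<in> set_pmf (joint pXY P Q)"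
    and w': "(x', y', z', m12, m23, m31') \<in> set_pmf (joint pXY P Q)"
  shows "y = y'"
proof -
  let ?v = "\<lambda>(m12, m23, m31). (m12, m23)"
  have "pZ x0 y = pZ x0 y'" if x0: "x0 \<in> T_set pXY y y'" for x0
  proof -
    have pos: "pmf pXY (x0, y) > 0" "pmf pXY (x0, y') > 0"
      using x0 by (auto simp: T_set_def)
    show ?thesis
    proof (rule pmf_eqI_exchange[OF view_output_Bob[OF pos(1), of "(m12, m23)"]
          view_output_Bob[OF pos(2), of "(m12, m23)"]])
      show "law (joint pXY P Q) (\<lambda>(x, y, z, m12, m23, m31). ((m12, m23), y)) ((m12, m23), y) > 0"
        "law (joint pXY P Q) (\<lambda>(x, y, z, m12, m23, m31). ((m12, m23), y)) ((m12, m23), y') > 0"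
        using w w' by (force intro!: pmf_positive)+
      show "pmf (view_output ?v P (Q x0 y)) ((m12, m23), t) * pmf (view_output ?v P (Q x0 y')) ((m12, m23), t') =
        pmf (view_output ?v P (Q x0 y)) ((m12, m23), t') * pmf (view_output ?v P (Q x0 y')) ((m12, m23), t)" for t t'
        unfolding view_output_def
      proof (rule pmf_bind_exchange)
        fix m n :: "bool list \<times> bool list \<times> bool list" assume "?v m = ?v n"
        then obtain a b c c' where "m = (a, b, c)" "n = (a, b, c')"
          by (cases m, cases n) auto
        then show "pmf (Q x0 y) m * pmf (Q x0 y') n = pmf (Q x0 y) n * pmf (Q x0 y') m"
          by (simp only:) (rule transcript_exchange_Bob[OF secure_valid secure_transcript_dist[OF pos(1)] secure_transcript_dist[OF pos(2)]])
      qed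
    qed
  qed
  then have "equiv_y pXY pZ y y'" unfolding equiv_y_def by simp
  then show ?thesis by (rule normal[unfolded normal_form_def, THEN conjunct2, THEN conjunct1, rule_format])
qed

text \<open>Here the exchange property is not needed: Charlie's output depends on his transcripts alone, so
  on a fixed view the probabilities of two outputs are in a ratio that does not depend on the inputs.\<close>

lemma Charlie_view_determines_output:
  assumes w: "(x, y, z, m12, m23, m31) \<in> set_pmf (joint pXY P Q)"
    and w': "(x', y', z', m12', m23, m31) \<in> set_pmf (joint pXY P Q)"
  shows "z = z'"
proof -
  let ?out = "pmf (output3 P m23 m31)"
  let ?c = "law (joint pXY P Q) (\<lambda>(x, y, z, m). z)"
  let ?k = "\<lambda>t. law (joint pXY P Q) (\<lambda>(x, y, z, m12, m23, m31). ((m23, m31), z)) ((m23, m31), t)"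
  \<comment> \<open>Charlie's view is exactly what \<open>output3\<close> reads, so given the view
    the output law no longer depends on \<open>q\<close>.\<close>
  have view: "pmf (view_output snd P q) ((m23, m31), t) = pmf (map_pmf snd q) (m23, m31) * ?out t" for q t
  proof -
    have "view_output snd P q = map_pmf snd q \<bind> (\<lambda>m. map_pmf (Pair m) (output3 P (fst m) (snd m)))"
      by (auto simp: view_output_def bind_map_pmf intro!: bind_pmf_cong)
    also have "pmf \<dots> ((m23, m31), t) =
        pmf (map_pmf snd q) (m23, m31) * pmf (map_pmf (Pair (m23, m31)) (output3 P m23 m31)) ((m23, m31), t)"
      by (subst pmf_bind_single[of _ "(m23, m31)"]) (auto simp: pmf_eq_0_set_pmf)
    finally show ?thesis by (simp add: pmf_map_inj' inj_def)
  qed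
  have pos: "?k z > 0" "?k z' > 0" "?c z > 0" "?c z' > 0" "?out z > 0" "?out z' > 0"
    using w w' by (force intro!: pmf_positive simp: joint_def set_bind_pmf)+
  have "equiv_z pXY pZ z z'"
    unfolding equiv_z_def
  \<comment> \<open>The constant is the quotient of the coefficients of \<open>?T\<close> in the two
    formulas for \<open>pmf (pZ x y)\<close> below.\<close>
  proof (intro exI[of _ "?out z * ?c z * ?k z' / (?out z' * ?c z' * ?k z)"] conjI allI impI)
    show "0 \<le> ?out z * ?c z * ?k z' / (?out z' * ?c z' * ?k z)" by simp
    fix x y assume xy: "0 < pmf pXY (x, y)"
    let ?T = "pmf (map_pmf snd (Q x y)) (m23, m31)"
    have "?T * ?out t * ?c t = ?k t * pmf (pZ x y) t" for t
      using view_output_Charlie[OF xy, of "(m23, m31)" t] by (simp add: view)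
    from this[of z] this[of z'] have "pmf (pZ x y) z = ?T * ?out z * ?c z / ?k z"
      "pmf (pZ x y) z' = ?T * ?out z' * ?c z' / ?k z'"
      using pos by (simp_all add: field_simps)
    then show "pmf (pZ x y) z = ?out z * ?c z * ?k z' / (?out z' * ?c z' * ?k z) * pmf (pZ x y) z'"
      using pos by simp
  qed
  then show ?thesis by (rule normal[unfolded normal_form_def, THEN conjunct2, THEN conjunct2, rule_format])
qed

end

section \<open>The lower bounds\<close>

theorem theorem1:
  fixes pXY :: "('x::finite \<times> 'y::finite) pmf"
    and pZ :: "'x \<Rightarrow> 'y \<Rightarrow> 'z::finite pmf"
    and P :: "('x, 'y, 'z) protocol"
    and Q :: "'x \<Rightarrow> 'y \<Rightarrow> (bool list \<times> bool list \<times> bool list) pmf"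
  assumes "normal_form pXY pZ"
    and "secure_protocol pXY pZ P Q"
  defines "J \<equiv> joint pXY P Q"
  shows
    "ennreal (max (resid_info (map_pmf (\<lambda>(x, y, z, m). (x, z)) J))
                  (resid_info (map_pmf (\<lambda>(x, y, z, m). (x, y)) J))
              + cond_ent (map_pmf (\<lambda>(x, y, z, m). ((y, z), x)) J))
       \<le> ent_inf (map_pmf (\<lambda>(x, y, z, m12, m23, m31). m23) J) \<and>
     ennreal (max (resid_info (map_pmf (\<lambda>(x, y, z, m). (y, z)) J))
                  (resid_info (map_pmf (\<lambda>(x, y, z, m). (x, y)) J))
              + cond_ent (map_pmf (\<lambda>(x, y, z, m). ((x, z), y)) J))
       \<le> ent_inf (map_pmf (\<lambda>(x, y, z, m12, m23, m31). m31) J) \<and>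
     ennreal (max (resid_info (map_pmf (\<lambda>(x, y, z, m). (x, z)) J))
                  (resid_info (map_pmf (\<lambda>(x, y, z, m). (y, z)) J))
              + cond_ent (map_pmf (\<lambda>(x, y, z, m). ((x, y), z)) J))
       \<le> ent_inf (map_pmf (\<lambda>(x, y, z, m12, m23, m31). m12) J)"
proof -
  \<comment> \<open>Named coordinates bring every tuple pattern into the form used by
    \<open>link_entropy_bound_max\<close>.\<close>
  define X Y Z M12 M23 M31 where
    proj: "X = (\<lambda>(x :: 'x, y :: 'y, z :: 'z, m :: bool list \<times> bool list \<times> bool list). x)"
    "Y = (\<lambda>(x :: 'x, y :: 'y, z :: 'z, m :: bool list \<times> bool list \<times> bool list). y)"
    "Z = (\<lambda>(x :: 'x, y :: 'y, z :: 'z, m :: bool list \<times> bool list \<times> bool list). z)"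
    "M12 = (\<lambda>(x :: 'x, y :: 'y, z :: 'z, m12 :: bool list, m23 :: bool list, m31 :: bool list). m12)"
    "M23 = (\<lambda>(x :: 'x, y :: 'y, z :: 'z, m12 :: bool list, m23 :: bool list, m31 :: bool list). m23)"
    "M31 = (\<lambda>(x :: 'x, y :: 'y, z :: 'z, m12 :: bool list, m23 :: bool list, m31 :: bool list). m31)"
  have pairs: "(\<lambda>(x, y, z, m). (x, z)) = (\<lambda>w. (X w, Z w))" "(\<lambda>(x, y, z, m). (x, y)) = (\<lambda>w. (X w, Y w))"
    "(\<lambda>(x, y, z, m). (y, z)) = (\<lambda>w. (Y w, Z w))" "(\<lambda>(x, y, z, m). ((y, z), x)) = (\<lambda>w. ((Y w, Z w), X w))"
    "(\<lambda>(x, y, z, m). ((x, z), y)) = (\<lambda>w. ((X w, Z w), Y w))"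
    "(\<lambda>(x, y, z, m). ((x, y), z)) = (\<lambda>w. ((X w, Y w), Z w))"
    "(\<lambda>(x, y, z, m12, m23, m31). (m12, m31)) = (\<lambda>w. (M12 w, M31 w))"
    "(\<lambda>(x, y, z, m12, m23, m31). (m12, m23)) = (\<lambda>w. (M12 w, M23 w))"
    "(\<lambda>(x, y, z, m12, m23, m31). (m23, m31)) = (\<lambda>w. (M23 w, M31 w))"
    by (auto simp: proj fun_eq_iff)
  note mark = secure_privacy[OF assms(1,2), folded J_def, unfolded pairs, folded proj]
  have detX: "X v = X w" if "v \<in> set_pmf J" "w \<in> set_pmf J" "M12 v = M12 w" "M31 v = M31 w" for v w
    using that by (cases v, cases w) (auto simp: proj J_def dest: Alice_view_determines_input[OF assms(1,2)])
  have detY: "Y v = Y w" if "v \<in> set_pmf J" "w \<in> set_pmf J" "M12 v = M12 w" "M23 v = M23 w" for v w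
    using that by (cases v, cases w) (auto simp: proj J_def dest: Bob_view_determines_input[OF assms(1,2)])
  have detZ: "Z v = Z w" if "v \<in> set_pmf J" "w \<in> set_pmf J" "M23 v = M23 w" "M31 v = M31 w" for v w
    using that by (cases v, cases w) (auto simp: proj J_def dest: Charlie_view_determines_output[OF assms(1,2)])
  \<comment> \<open>For each link, \<open>S\<close> is the variable of the party off that link, and
    \<open>B\<close> and \<open>C\<close> are that party's two links. Here this party is Alice:
    \<open>S\<close> is \<open>X\<close>, \<open>U\<close> is \<open>Z\<close> and \<open>R\<close>
    is \<open>Y\<close>.\<close>
  have "ennreal (max (resid_info (map_pmf (\<lambda>w. (X w, Z w)) J)) (resid_info (map_pmf (\<lambda>w. (X w, Y w)) J))
      + cond_ent (map_pmf (\<lambda>w. ((Z w, Y w), X w)) J)) \<le> ent_inf (map_pmf M23 J)"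
  proof (rule link_entropy_bound_max[where B = M12 and C = M31])
    show "markov J (\<lambda>w. (M12 w, M31 w)) X (\<lambda>w. (Z w, Y w))"
      by (rule markov_comp[OF mark(1), where h = id and k = prod.swap]) auto
    show "markov J M31 Z X" by (rule markov_comp[OF mark(3), where h = snd and k = fst]) auto
    show "markov J M12 Y X" by (rule markov_comp[OF mark(2), where h = fst and k = fst]) auto
  qed (blast intro: detX detY detZ)+
  moreover have "ennreal (max (resid_info (map_pmf (\<lambda>w. (Y w, Z w)) J)) (resid_info (map_pmf (\<lambda>w. (Y w, X w)) J))
      + cond_ent (map_pmf (\<lambda>w. ((Z w, X w), Y w)) J)) \<le> ent_inf (map_pmf M31 J)"
  proof (rule link_entropy_bound_max[where B = M12 and C = M23])
    show "markov J (\<lambda>w. (M12 w, M23 w)) Y (\<lambda>w. (Z w, X w))"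
      by (rule markov_comp[OF mark(2), where h = id and k = prod.swap]) auto
    show "markov J M23 Z Y" by (rule markov_comp[OF mark(3), where h = fst and k = snd]) auto
    show "markov J M12 X Y" by (rule markov_comp[OF mark(1), where h = fst and k = fst]) auto
  qed (blast intro: detX detY detZ)+
  moreover have "ennreal (max (resid_info (map_pmf (\<lambda>w. (Z w, X w)) J)) (resid_info (map_pmf (\<lambda>w. (Z w, Y w)) J))
      + cond_ent (map_pmf (\<lambda>w. ((X w, Y w), Z w)) J)) \<le> ent_inf (map_pmf M12 J)"
  proof (rule link_entropy_bound_max[where B = M23 and C = M31])
    show "markov J (\<lambda>w. (M23 w, M31 w)) Z (\<lambda>w. (X w, Y w))" by (rule mark(3))
    show "markov J M31 X Z" by (rule markov_comp[OF mark(1), where h = snd and k = snd]) auto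
    show "markov J M23 Y Z" by (rule markov_comp[OF mark(2), where h = snd and k = snd]) auto
  qed (blast intro: detX detY detZ)+
  ultimately show ?thesis
    unfolding pairs proj[symmetric]
    by (simp add: resid_info_swap[of Y X] resid_info_swap[of Z X] resid_info_swap[of Z Y]
        cond_ent_swap[of Z Y X] cond_ent_swap[of Z X Y])
qed

end
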